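(* Let $u,\bar u,v,\bar v$ be the functions on $\Omega$ defined in the context. Then: (i) at all points of $\Omega$ where $u\bar u\ne1$, the pair $(w,\bar w)=(u,\bar u)$ satisfies the Euler equations of the Lagrangian $$\mathcal L_+=\frac{(\partial_\xi w)(\partial_\eta\bar w)}{1-w\bar w}+w\bar w;$$ (ii) at all points of $\Omega$ where $v\bar v\ne1$, the pair $(w,\bar w)=(v,\bar v)$ satisfies the Euler equations of the Lagrangian $$\mathcal L_-=\frac{(\partial_\xi w)(\partial_\eta\bar w)}{1-w\bar w}-w\bar w.$$
   Context: The overbar does NOT denote complex conjugation; barred and unbarred quantities are independent. Fix $N\ge 1$ and complex constants $L_j,\bar L_j,\alpha_j,\bar\alpha_j,c_j,\bar c_j$ ($1\le j\le N$) with $L_j\ne0$, $\bar L_j\neq 0$ and $L_j\neq\bar L_k$ for all $j,k$. Put $\mathsf L=\mathrm{diag}(L_1,\dots,L_N)$, $\bar{\mathsf L}=\mathrm{diag}(\bar L_1,\dots,\bar L_N)$, columns $|\alpha\rangle=(\alpha_1,\dots,\alpha_N)^T$, $|\bar\alpha\rangle=(\bar\alpha_1,\dots,\bar\alpha_N)^T$, rows $\langle c|=(c_1,\dots,c_N)$, $\langle\bar c|=(\bar c_1,\dots,\bar c_N)$. For $(\xi,\eta)\in\mathbb C^2$ define the rows $$\langle a|=\langle c|\exp(\xi\mathsf L^{-1}-\eta\mathsf L),\qquad \langle\bar a|=\langle\bar c|\exp(-\xi\bar{\mathsf L}^{-1}+\eta\bar{\mathsf L}),$$ and the $N\times N$ matrices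 $$\mathsf A=\Big(\frac{\alpha_jc_k}{\bar L_j-L_k}\Big)_{j,k=1}^{N}\exp(\xi\mathsf L^{-1}-\eta\mathsf L),\qquad \bar{\mathsf A}=\Big(\frac{\bar\alpha_j\bar c_k}{L_j-\bar L_k}\Big)_{j,k=1}^{N}\exp(-\xi\bar{\mathsf L}^{-1}+\eta\bar{\mathsf L}),$$ which satisfy $\bar{\mathsf L}\mathsf A-\mathsf A\mathsf L=|\alpha\rangle\langle a|$ and $\mathsf L\bar{\mathsf A}-\bar{\mathsf A}\bar{\mathsf L}=|\bar\alpha\rangle\langle\bar a|$. Let $\Omega\subset\mathbb C^2$ be the open set where $\det(1+\mathsf A\bar{\mathsf A})\ne0$, and on $\Omega$ put $\mathsf G=(1+\mathsf A\bar{\mathsf A})^{-1}$, $\bar{\mathsf G}=(1+\bar{\mathsf A}\mathsf A)^{-1}$. Put $|\beta\rangle=\bar{\mathsf L}^{-1}|\alpha\rangle$, $|\bar\beta\rangle=\mathsf L^{-1}|\bar\alpha\rangle$. Define the scalar functions on $\Omega$ $$u=1-\langle\bar a|\mathsf G\mathsf A|\bar\beta\rangle,\quad v=\langle\bar a|\mathsf G|\beta\rangle,\quad \bar u=1-\langle a|\bar{\mathsf G}\bar{\mathsf A}|\beta\rangle,\quad \bar v=\langle a|\bar{\mathsf G}|\bar\beta\rangle.$$ The Euler equations of a Lagrangian $\mathcal L(w,\bar w,\partial_\xi w,\partial_\eta\bar w)$, with $w$ and $\bar w$ independent fields, are $\partial\mathcal L/\partial w-\partial_\xi\big(\partial\mathcal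 L/\partial(\partial_\xi w)\big)=0$ and $\partial\mathcal L/\partial\bar w-\partial_\eta\big(\partial\mathcal L/\partial(\partial_\eta\bar w)\big)=0$. *)

theory Defs
  imports "HOL-Analysis.Analysis"
begin

section \<open>Matrices\<close>

text \<open>
  Rows and columns are both vectors of type \<^typ>\<open>complex ^ 'n\<close>; the size of the system is
  \<open>CARD('n)\<close>. The library inner product on \<^typ>\<open>complex ^ 'n\<close> is real-valued, so the
  (bilinear, unconjugated) product of a row with a column is defined here.
\<close>

definition row_col :: "complex ^ 'n \<Rightarrow> complex ^ 'n \<Rightarrow> complex"
  where "row_col r s = (\<Sum>i\<in>UNIV. r $ i * s $ i)"

definition col_row :: "complex ^ 'n \<Rightarrow> complex ^ 'n \<Rightarrow> complex ^ 'n ^ 'n"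
  where "col_row s r = (\<chi> j k. s $ j * r $ k)"

definition diag :: "complex ^ 'n \<Rightarrow> complex ^ 'n ^ 'n"
  where "diag d = (\<chi> i j. if i = j then d $ i else 0)"

text \<open>
  The multiplication \<open>*\<close> and the power \<open>^\<close> of the library act on vectors componentwise, so powers
  of a matrix are iterates of \<open>**\<close>.
\<close>

definition mexp :: "complex ^ 'n ^ 'n \<Rightarrow> complex ^ 'n ^ 'n"
  where "mexp M = (\<Sum>k. (1 / fact k) *\<^sub>R (((**) M ^^ k) (mat 1)))"

lemma diag_mult_diag:
  fixes d e :: "complex ^ 'n"
  shows "diag d ** diag e = diag (\<chi> i. d $ i * e $ i)"
proof -
  have "(\<Sum>k\<in>UNIV. (if i = k then d $ i else 0) * (if k = j then e $ k else 0))
      = (if i = j then d $ i * e $ i else 0)" for i j :: 'n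
    by (subst sum.remove[of _ i]) auto
  then show ?thesis
    by (simp add: diag_def matrix_matrix_mult_def vec_eq_iff)
qed

lemma mat_eq_diag: "mat x = diag (\<chi> i. x)"
  by (simp add: diag_def mat_def vec_eq_iff)

lemma matrix_power_diag: "((**) (diag d) ^^ k) (mat 1) = diag (\<chi> i. d $ i ^ k)"
  by (induction k) (simp_all add: mat_eq_diag diag_mult_diag)

lemma mexp_diag:
  fixes d :: "complex ^ 'n"
  shows "mexp (diag d) = diag (\<chi> i. exp (d $ i))"
proof -
  have "(\<lambda>k. (1 / fact k) *\<^sub>R (diag (\<chi> i. d $ i ^ k))) sums diag (\<chi> i. exp (d $ i))"
    unfolding sums_def
  proof (intro vec_tendstoI)
    fix i j :: 'n
    have "(\<lambda>k. (1 / fact k) *\<^sub>R (d $ i ^ k)) sums exp (d $ i)"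
      using exp_converges[of "d $ i"] by (simp add: divide_inverse)
    then show "(\<lambda>n. (\<Sum>k<n. (1 / fact k) *\<^sub>R (diag (\<chi> i. d $ i ^ k))) $ i $ j)
        \<longlonglongrightarrow> diag (\<chi> i. exp (d $ i)) $ i $ j"
      by (cases "i = j") (simp_all add: diag_def sums_def)
  qed
  then show ?thesis
    unfolding mexp_def matrix_power_diag by (simp add: sums_iff)
qed

lemma matrix_inv_diag:
  assumes "\<And>j. d $ j \<noteq> 0"
  shows "matrix_inv (diag d) = diag (\<chi> j. 1 / d $ j)"
proof -
  let ?E = "diag (\<chi> j. 1 / d $ j)"
  have 1: "diag d ** ?E = mat 1" "?E ** diag d = mat 1"
    using assms by (simp_all add: diag_mult_diag mat_eq_diag)
  then have "invertible (diag d)"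
    unfolding invertible_def by blast
  then have "diag d ** matrix_inv (diag d) = mat 1"
    unfolding invertible_def matrix_inv_def by (rule someI2_ex) blast
  then show ?thesis
    by (metis 1(2) matrix_mul_assoc matrix_mul_lid matrix_mul_rid)
qed


section \<open>The functions \<open>u\<close>, \<open>v\<close> and their barred counterparts\<close>

text \<open>
  The suffix \<open>b\<close> stands for the overbar; barred and unbarred quantities are independent, and the
  overbar is not complex conjugation.
\<close>

definition expo :: "complex ^ 'n \<Rightarrow> complex \<Rightarrow> complex \<Rightarrow> complex ^ 'n ^ 'n"
  where "expo L \<xi> \<eta> = mexp (mat \<xi> ** matrix_inv (diag L) - mat \<eta> ** diag L)"

definition expob :: "complex ^ 'n \<Rightarrow> complex \<Rightarrow> complex \<Rightarrow> complex ^ 'n ^ 'n"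
  where "expob Lb \<xi> \<eta> = mexp (- (mat \<xi> ** matrix_inv (diag Lb)) + mat \<eta> ** diag Lb)"

definition a_row :: "complex ^ 'n \<Rightarrow> complex ^ 'n \<Rightarrow> complex \<Rightarrow> complex \<Rightarrow> complex ^ 'n"
  where "a_row L c \<xi> \<eta> = c v* expo L \<xi> \<eta>"

definition ab_row :: "complex ^ 'n \<Rightarrow> complex ^ 'n \<Rightarrow> complex \<Rightarrow> complex \<Rightarrow> complex ^ 'n"
  where "ab_row Lb cb \<xi> \<eta> = cb v* expob Lb \<xi> \<eta>"

definition A_mat :: "complex ^ 'n \<Rightarrow> complex ^ 'n \<Rightarrow> complex ^ 'n \<Rightarrow> complex ^ 'n
    \<Rightarrow> complex \<Rightarrow> complex \<Rightarrow> complex ^ 'n ^ 'n"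
  where "A_mat L Lb \<alpha> c \<xi> \<eta> = (\<chi> j k. \<alpha> $ j * c $ k / (Lb $ j - L $ k)) ** expo L \<xi> \<eta>"

definition Ab_mat :: "complex ^ 'n \<Rightarrow> complex ^ 'n \<Rightarrow> complex ^ 'n \<Rightarrow> complex ^ 'n
    \<Rightarrow> complex \<Rightarrow> complex \<Rightarrow> complex ^ 'n ^ 'n"
  where "Ab_mat L Lb \<alpha>b cb \<xi> \<eta> = (\<chi> j k. \<alpha>b $ j * cb $ k / (L $ j - Lb $ k)) ** expob Lb \<xi> \<eta>"

definition Omega :: "complex ^ 'n \<Rightarrow> complex ^ 'n \<Rightarrow> complex ^ 'n \<Rightarrow> complex ^ 'n
    \<Rightarrow> complex ^ 'n \<Rightarrow> complex ^ 'n \<Rightarrow> (complex \<times> complex) set"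
  where "Omega L Lb \<alpha> \<alpha>b c cb =
    {(\<xi>, \<eta>). det (mat 1 + A_mat L Lb \<alpha> c \<xi> \<eta> ** Ab_mat L Lb \<alpha>b cb \<xi> \<eta>) \<noteq> 0}"

definition G_mat :: "complex ^ 'n \<Rightarrow> complex ^ 'n \<Rightarrow> complex ^ 'n \<Rightarrow> complex ^ 'n
    \<Rightarrow> complex ^ 'n \<Rightarrow> complex ^ 'n \<Rightarrow> complex \<Rightarrow> complex \<Rightarrow> complex ^ 'n ^ 'n"
  where "G_mat L Lb \<alpha> \<alpha>b c cb \<xi> \<eta> =
    matrix_inv (mat 1 + A_mat L Lb \<alpha> c \<xi> \<eta> ** Ab_mat L Lb \<alpha>b cb \<xi> \<eta>)"

text \<open>
  On \<open>Omega\<close> this is a genuine inverse as well, because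
  \<open>det (mat 1 + Ab ** A) = det (mat 1 + A ** Ab)\<close>.
\<close>

definition Gb_mat :: "complex ^ 'n \<Rightarrow> complex ^ 'n \<Rightarrow> complex ^ 'n \<Rightarrow> complex ^ 'n
    \<Rightarrow> complex ^ 'n \<Rightarrow> complex ^ 'n \<Rightarrow> complex \<Rightarrow> complex \<Rightarrow> complex ^ 'n ^ 'n"
  where "Gb_mat L Lb \<alpha> \<alpha>b c cb \<xi> \<eta> =
    matrix_inv (mat 1 + Ab_mat L Lb \<alpha>b cb \<xi> \<eta> ** A_mat L Lb \<alpha> c \<xi> \<eta>)"

definition beta_col :: "complex ^ 'n \<Rightarrow> complex ^ 'n \<Rightarrow> complex ^ 'n"
  where "beta_col Lb \<alpha> = matrix_inv (diag Lb) *v \<alpha>"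

definition betab_col :: "complex ^ 'n \<Rightarrow> complex ^ 'n \<Rightarrow> complex ^ 'n"
  where "betab_col L \<alpha>b = matrix_inv (diag L) *v \<alpha>b"

definition u_fun :: "complex ^ 'n \<Rightarrow> complex ^ 'n \<Rightarrow> complex ^ 'n \<Rightarrow> complex ^ 'n
    \<Rightarrow> complex ^ 'n \<Rightarrow> complex ^ 'n \<Rightarrow> complex \<Rightarrow> complex \<Rightarrow> complex"
  where "u_fun L Lb \<alpha> \<alpha>b c cb \<xi> \<eta> =
    1 - row_col (ab_row Lb cb \<xi> \<eta>)
          ((G_mat L Lb \<alpha> \<alpha>b c cb \<xi> \<eta> ** A_mat L Lb \<alpha> c \<xi> \<eta>) *v betab_col L \<alpha>b)"

definition v_fun :: "complex ^ 'n \<Rightarrow> complex ^ 'n \<Rightarrow> complex ^ 'n \<Rightarrow> complex ^ 'n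
    \<Rightarrow> complex ^ 'n \<Rightarrow> complex ^ 'n \<Rightarrow> complex \<Rightarrow> complex \<Rightarrow> complex"
  where "v_fun L Lb \<alpha> \<alpha>b c cb \<xi> \<eta> =
    row_col (ab_row Lb cb \<xi> \<eta>) (G_mat L Lb \<alpha> \<alpha>b c cb \<xi> \<eta> *v beta_col Lb \<alpha>)"

definition ub_fun :: "complex ^ 'n \<Rightarrow> complex ^ 'n \<Rightarrow> complex ^ 'n \<Rightarrow> complex ^ 'n
    \<Rightarrow> complex ^ 'n \<Rightarrow> complex ^ 'n \<Rightarrow> complex \<Rightarrow> complex \<Rightarrow> complex"
  where "ub_fun L Lb \<alpha> \<alpha>b c cb \<xi> \<eta> =
    1 - row_col (a_row L c \<xi> \<eta>)
          ((Gb_mat L Lb \<alpha> \<alpha>b c cb \<xi> \<eta> ** Ab_mat L Lb \<alpha>b cb \<xi> \<eta>) *v beta_col Lb \<alpha>)"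

definition vb_fun :: "complex ^ 'n \<Rightarrow> complex ^ 'n \<Rightarrow> complex ^ 'n \<Rightarrow> complex ^ 'n
    \<Rightarrow> complex ^ 'n \<Rightarrow> complex ^ 'n \<Rightarrow> complex \<Rightarrow> complex \<Rightarrow> complex"
  where "vb_fun L Lb \<alpha> \<alpha>b c cb \<xi> \<eta> =
    row_col (a_row L c \<xi> \<eta>) (Gb_mat L Lb \<alpha> \<alpha>b c cb \<xi> \<eta> *v betab_col L \<alpha>b)"

text \<open>The identities satisfied by the two matrices (this is where \<open>L\<close> and \<open>Lb\<close> must be disjoint).\<close>

lemma diag_mult_nth: "(diag d ** M) $ j $ k = d $ j * M $ j $ k"
proof -
  have "(\<Sum>i\<in>UNIV. (if j = i then d $ j else 0) * M $ i $ k) = d $ j * M $ j $ k"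
    by (subst sum.remove[of _ j]) auto
  then show ?thesis
    by (simp add: diag_def matrix_matrix_mult_def)
qed

lemma mult_diag_nth: "(M ** diag d) $ j $ k = M $ j $ k * d $ k"
proof -
  have "(\<Sum>i\<in>UNIV. M $ j $ i * (if i = k then d $ i else 0)) = M $ j $ k * d $ k"
    by (subst sum.remove[of _ k]) auto
  then show ?thesis
    by (simp add: diag_def matrix_matrix_mult_def)
qed

lemma vec_mult_diag_nth: "(r v* diag d) $ k = r $ k * d $ k"
proof -
  have "(\<Sum>i\<in>UNIV. r $ i * (if i = k then d $ i else 0)) = r $ k * d $ k"
    by (subst sum.remove[of _ k]) auto
  then show ?thesis
    by (simp add: diag_def vector_matrix_mult_def)
qed

lemma expo_eq:
  assumes "\<And>j. L $ j \<noteq> 0"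
  shows "expo L \<xi> \<eta> = diag (\<chi> j. exp (\<xi> / L $ j - \<eta> * L $ j))"
proof -
  have "mat \<xi> ** matrix_inv (diag L) - mat \<eta> ** diag L = diag (\<chi> j. \<xi> / L $ j - \<eta> * L $ j)"
    unfolding matrix_inv_diag[OF assms] mat_eq_diag diag_mult_diag
    by (simp add: diag_def vec_eq_iff)
  then show ?thesis
    by (simp add: expo_def mexp_diag)
qed

lemma expob_eq:
  assumes "\<And>j. Lb $ j \<noteq> 0"
  shows "expob Lb \<xi> \<eta> = diag (\<chi> j. exp (- \<xi> / Lb $ j + \<eta> * Lb $ j))"
proof -
  have "- (mat \<xi> ** matrix_inv (diag Lb)) + mat \<eta> ** diag Lb
      = diag (\<chi> j. - \<xi> / Lb $ j + \<eta> * Lb $ j)"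
    unfolding matrix_inv_diag[OF assms] mat_eq_diag diag_mult_diag
    by (simp add: diag_def vec_eq_iff)
  then show ?thesis
    by (simp add: expob_def mexp_diag)
qed

lemma A_mat_Sylvester:
  assumes "\<And>j. L $ j \<noteq> 0" "\<And>j k. L $ j \<noteq> Lb $ k"
  shows "diag Lb ** A_mat L Lb \<alpha> c \<xi> \<eta> - A_mat L Lb \<alpha> c \<xi> \<eta> ** diag L = col_row \<alpha> (a_row L c \<xi> \<eta>)"
proof -
  have *: "Lb $ j * (x / (Lb $ j - L $ k) * e) - x / (Lb $ j - L $ k) * e * L $ k = x * e"
    for j k x e
  proof -
    have "Lb $ j - L $ k \<noteq> 0"
      using assms(2)[of k j] by auto
    then have "(Lb $ j - L $ k) * (x / (Lb $ j - L $ k)) = x"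
      by simp
    then show ?thesis
      by (metis left_diff_distrib mult.assoc mult.commute)
  qed
  show ?thesis
    unfolding A_mat_def a_row_def expo_eq[OF assms(1)] vec_eq_iff col_row_def
    by (simp add: diag_mult_nth mult_diag_nth vec_mult_diag_nth * del: times_divide_eq_left times_divide_eq_right)
qed

lemma Ab_mat_Sylvester:
  assumes "\<And>j. Lb $ j \<noteq> 0" "\<And>j k. L $ j \<noteq> Lb $ k"
  shows "diag L ** Ab_mat L Lb \<alpha>b cb \<xi> \<eta> - Ab_mat L Lb \<alpha>b cb \<xi> \<eta> ** diag Lb
    = col_row \<alpha>b (ab_row Lb cb \<xi> \<eta>)"
proof -
  have *: "L $ j * (x / (L $ j - Lb $ k) * e) - x / (L $ j - Lb $ k) * e * Lb $ k = x * e"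
    for j k x e
  proof -
    have "L $ j - Lb $ k \<noteq> 0"
      using assms(2)[of j k] by auto
    then have "(L $ j - Lb $ k) * (x / (L $ j - Lb $ k)) = x"
      by simp
    then show ?thesis
      by (metis left_diff_distrib mult.assoc mult.commute)
  qed
  show ?thesis
    unfolding Ab_mat_def ab_row_def expob_eq[OF assms(1)] vec_eq_iff col_row_def
    by (simp add: diag_mult_nth mult_diag_nth vec_mult_diag_nth * del: times_divide_eq_left times_divide_eq_right)
qed


section \<open>Euler equations\<close>

definition d_xi :: "(complex \<Rightarrow> complex \<Rightarrow> complex) \<Rightarrow> complex \<Rightarrow> complex \<Rightarrow> complex"
  where "d_xi f \<xi> \<eta> = deriv (\<lambda>x. f x \<eta>) \<xi>"

definition d_eta :: "(complex \<Rightarrow> complex \<Rightarrow> complex) \<Rightarrow> complex \<Rightarrow> complex \<Rightarrow> complex"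
  where "d_eta f \<xi> \<eta> = deriv (\<lambda>y. f \<xi> y) \<eta>"

text \<open>
  A Lagrangian is a function \<open>F w wb p q\<close> of four independent complex variables, where \<open>p\<close> and \<open>q\<close>
  stand for \<open>d_xi w\<close> and \<open>d_eta wb\<close>.
\<close>

type_synonym lagrangian = "complex \<Rightarrow> complex \<Rightarrow> complex \<Rightarrow> complex \<Rightarrow> complex"

definition along :: "lagrangian \<Rightarrow> (complex \<Rightarrow> complex \<Rightarrow> complex) \<Rightarrow> (complex \<Rightarrow> complex \<Rightarrow> complex)
    \<Rightarrow> complex \<Rightarrow> complex \<Rightarrow> complex"
  where "along F w wb \<xi> \<eta> = F (w \<xi> \<eta>) (wb \<xi> \<eta>) (d_xi w \<xi> \<eta>) (d_eta wb \<xi> \<eta>)"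

definition L_w :: "lagrangian \<Rightarrow> lagrangian"
  where "L_w F w wb p q = deriv (\<lambda>s. F s wb p q) w"

definition L_wb :: "lagrangian \<Rightarrow> lagrangian"
  where "L_wb F w wb p q = deriv (\<lambda>s. F w s p q) wb"

definition L_p :: "lagrangian \<Rightarrow> lagrangian"
  where "L_p F w wb p q = deriv (\<lambda>s. F w wb s q) p"

definition L_q :: "lagrangian \<Rightarrow> lagrangian"
  where "L_q F w wb p q = deriv (\<lambda>s. F w wb p s) q"

definition has_partials_at :: "lagrangian \<Rightarrow> complex \<Rightarrow> complex \<Rightarrow> complex \<Rightarrow> complex \<Rightarrow> bool"
  where "has_partials_at F w wb p q \<longleftrightarrow>
    (\<lambda>s. F s wb p q) field_differentiable at w \<and>
    (\<lambda>s. F w s p q) field_differentiable at wb \<and>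
    (\<lambda>s. F w wb s q) field_differentiable at p \<and>
    (\<lambda>s. F w wb p s) field_differentiable at q"

text \<open>
  The function \<^const>\<open>deriv\<close> is total, with an arbitrary value where there is no derivative. The
  first five conjuncts say that every derivative which occurs in the two equations (the last two
  conjuncts) exists.
\<close>

definition euler_equations_at :: "lagrangian \<Rightarrow> (complex \<Rightarrow> complex \<Rightarrow> complex)
    \<Rightarrow> (complex \<Rightarrow> complex \<Rightarrow> complex) \<Rightarrow> complex \<Rightarrow> complex \<Rightarrow> bool"
  where "euler_equations_at F w wb \<xi> \<eta> \<longleftrightarrow>
    (\<lambda>x. w x \<eta>) field_differentiable at \<xi> \<and>
    (\<lambda>y. wb \<xi> y) field_differentiable at \<eta> \<and>
    has_partials_at F (w \<xi> \<eta>) (wb \<xi> \<eta>) (d_xi w \<xi> \<eta>) (d_eta wb \<xi> \<eta>) \<and>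
    (\<lambda>x. along (L_p F) w wb x \<eta>) field_differentiable at \<xi> \<and>
    (\<lambda>y. along (L_q F) w wb \<xi> y) field_differentiable at \<eta> \<and>
    along (L_w F) w wb \<xi> \<eta> - d_xi (along (L_p F) w wb) \<xi> \<eta> = 0 \<and>
    along (L_wb F) w wb \<xi> \<eta> - d_eta (along (L_q F) w wb) \<xi> \<eta> = 0"

definition L_plus :: lagrangian
  where "L_plus w wb p q = p * q / (1 - w * wb) + w * wb"

definition L_minus :: lagrangian
  where "L_minus w wb p q = p * q / (1 - w * wb) - w * wb"

end

theory Submission
  imports Defs
begin

text \<open>
  With \<open>\<phi> = - a L\<inverse> Gb \<beta>b\<close>, \<open>\<psi> = - ab G \<alpha>\<close> and their barred counterparts \<open>\<phi>b = - ab Lb\<inverse> G \<beta>\<close>,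
  \<open>\<psi>b = - a Gb \<alpha>b\<close>, the Sylvester identities give \<open>1 - u ub = v vb\<close> and the first-order system
  \<open>u\<^sub>\<xi> = v \<phi>\<close>, \<open>u\<^sub>\<eta> = vb \<psi>\<close>, \<open>v\<^sub>\<xi> = u \<phi>b\<close>, \<open>v\<^sub>\<eta> = - ub \<psi>\<close>, \<open>\<psi>\<^sub>\<xi> = u v\<close>, \<open>\<phi>b\<^sub>\<eta> = - ub v\<close>,
  together with its barred version, in which all signs are reversed. Hence
  \<open>\<partial>\<^sub>\<eta> ub / (1 - u ub) = - \<psi>b / vb\<close> and \<open>\<partial>\<^sub>\<xi> u / (1 - u ub) = \<phi> / vb\<close>, and the Euler equations of the
  first Lagrangian are the quotient rule; \<open>v, vb\<close> are treated likewise.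

  The commutator computations produce two different expressions for each of \<open>u, v, ub, vb\<close>. They
  agree because \<open>diag ab ** G ** diag \<alpha>\<close> is a symmetric matrix, which comes from the Cauchy structure
  of \<open>A\<close> and \<open>Ab\<close>.
\<close>

subsection \<open>Matrix algebra\<close>

lemma matrix_mul_minus_left: "(- A) ** B = - (A ** (B :: complex ^ 'n ^ 'n))"
  and matrix_mul_minus_right: "A ** (- B) = - (A ** (B :: complex ^ 'n ^ 'n))"
  by (simp_all add: matrix_matrix_mult_def vec_eq_iff sum_negf)

lemma matrix_add_rdistrib: "(A + B) ** C = A ** C + B ** (C :: complex ^ 'n ^ 'n)"
  by (simp add: matrix_matrix_mult_def vec_eq_iff sum.distrib algebra_simps)

lemma matrix_sub_ldistrib: "A ** (B - C) = A ** B - A ** (C :: complex ^ 'n ^ 'n)"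
  and matrix_sub_rdistrib: "(A - B) ** C = A ** C - B ** (C :: complex ^ 'n ^ 'n)"
  by (simp_all add: matrix_matrix_mult_def vec_eq_iff sum_subtractf algebra_simps)

lemmas matrix_ring_simps = matrix_add_ldistrib matrix_add_rdistrib matrix_sub_ldistrib
  matrix_sub_rdistrib matrix_mul_minus_left matrix_mul_minus_right matrix_mul_assoc

lemma matrix_inv_inverse:
  fixes M :: "complex ^ 'n ^ 'n"
  assumes "det M \<noteq> 0"
  shows "M ** matrix_inv M = mat 1" "matrix_inv M ** M = mat 1"
proof -
  have "\<exists>N. M ** N = mat 1 \<and> N ** M = mat 1"
    using assms unfolding invertible_det_nz[symmetric] invertible_def .
  from someI_ex[OF this] show "M ** matrix_inv M = mat 1" "matrix_inv M ** M = mat 1"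
    unfolding matrix_inv_def by blast+
qed

lemma row_col_sum: "row_col r (M *v s) = (\<Sum>i\<in>UNIV. \<Sum>j\<in>UNIV. r $ i * M $ i $ j * s $ j)"
  by (simp add: row_col_def matrix_vector_mult_def sum_distrib_left mult_ac)

lemma row_col_matrix_add: "row_col r ((M + N) *v s) = row_col r (M *v s) + row_col r (N *v s)"
  and row_col_matrix_diff: "row_col r ((M - N) *v s) = row_col r (M *v s) - row_col r (N *v s)"
  and row_col_matrix_minus: "row_col r ((- M) *v s) = - row_col r (M *v s)"
  unfolding row_col_sum
  by (simp_all add: sum.distrib sum_subtractf sum_negf algebra_simps)

lemmas row_col_linear = row_col_matrix_add row_col_matrix_diff row_col_matrix_minus

lemma row_col_minus_left: "row_col (- r) s = - row_col r s"
  by (simp add: row_col_def sum_negf)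

lemma row_col_vector_matrix: "row_col (r v* M) s = row_col r (M *v s)"
proof -
  have "row_col (r v* M) s = (\<Sum>j\<in>UNIV. \<Sum>i\<in>UNIV. r $ i * M $ i $ j * s $ j)"
    by (simp add: row_col_def vector_matrix_mult_def sum_distrib_left mult_ac)
  also have "\<dots> = row_col r (M *v s)"
    unfolding row_col_sum by (rule sum.swap)
  finally show ?thesis .
qed

text \<open>A rank-one matrix inside a bilinear form splits it into a product of two scalars. The
  quadratic terms of the first-order system all come from here, since the Sylvester commutators have
  rank one.\<close>

lemma row_col_col_row:
  "row_col r ((M ** col_row p q ** N) *v s) = row_col r (M *v p) * row_col q (N *v s)"
proof -
  have *: "col_row p q *v t = row_col q t *s p" for t
    by (simp add: col_row_def row_col_def matrix_vector_mult_def vec_eq_iff sum_distrib_left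
        mult_ac)
  have "row_col r ((M ** col_row p q ** N) *v s) = row_col r (M *v (row_col q (N *v s) *s p))"
    by (simp add: matrix_vector_mul_assoc[symmetric] *)
  also have "\<dots> = row_col r (M *v p) * row_col q (N *v s)"
    by (simp add: row_col_sum sum_distrib_right mult_ac)
  finally show ?thesis .
qed


lemma col_row_mult: "M ** col_row p q ** N = col_row (M *v p) (q v* N)"
  by (simp add: col_row_def matrix_matrix_mult_def matrix_vector_mult_def vector_matrix_mult_def
      vec_eq_iff sum_distrib_left sum_distrib_right mult_ac)

lemma vec_mult_minus_diag: "- (r v* - diag d) = r v* diag d"
  by (simp add: vector_matrix_mult_def vec_eq_iff sum_negf)


subsection \<open>Differentiation of matrices\<close>

definition has_matrix_derivative ::
    "(complex \<Rightarrow> complex ^ 'n ^ 'm) \<Rightarrow> complex ^ 'n ^ 'm \<Rightarrow> complex \<Rightarrow> bool"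
  where "has_matrix_derivative M M' t \<longleftrightarrow>
    (\<forall>i j. ((\<lambda>x. M x $ i $ j) has_field_derivative M' $ i $ j) (at t))"

definition has_row_derivative ::
    "(complex \<Rightarrow> complex ^ 'n) \<Rightarrow> complex ^ 'n \<Rightarrow> complex \<Rightarrow> bool"
  where "has_row_derivative r r' t \<longleftrightarrow>
    (\<forall>i. ((\<lambda>x. r x $ i) has_field_derivative r' $ i) (at t))"

lemma has_matrix_derivative_add_const:
  assumes "has_matrix_derivative M M' t"
  shows "has_matrix_derivative (\<lambda>x. K + M x) M' t"
  using assms unfolding has_matrix_derivative_def by (auto intro!: derivative_eq_intros)

lemma has_matrix_derivative_mult:
  fixes M N :: "complex \<Rightarrow> complex ^ 'n ^ 'n"
  assumes "has_matrix_derivative M M' t" "has_matrix_derivative N N' t"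
  shows "has_matrix_derivative (\<lambda>x. M x ** N x) (M' ** N t + M t ** N') t"
  unfolding has_matrix_derivative_def
proof (intro allI)
  fix i j
  have "((\<lambda>x. \<Sum>k\<in>UNIV. M x $ i $ k * N x $ k $ j) has_field_derivative
      (\<Sum>k\<in>UNIV. M' $ i $ k * N t $ k $ j + N' $ k $ j * M t $ i $ k)) (at t)"
    using assms unfolding has_matrix_derivative_def
    by (intro DERIV_sum DERIV_mult) auto
  then show "((\<lambda>x. (M x ** N x) $ i $ j) has_field_derivative
      (M' ** N t + M t ** N') $ i $ j) (at t)"
    by (simp add: matrix_matrix_mult_def sum.distrib mult_ac)
qed

lemma has_field_derivative_row_col:
  assumes "has_row_derivative r r' t" "has_matrix_derivative M M' t"
  shows "((\<lambda>x. row_col (r x) (M x *v s)) has_field_derivative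
    row_col r' (M t *v s) + row_col (r t) (M' *v s)) (at t)"
proof -
  have "((\<lambda>x. \<Sum>i\<in>UNIV. \<Sum>j\<in>UNIV. r x $ i * M x $ i $ j * s $ j) has_field_derivative
      (\<Sum>i\<in>UNIV. \<Sum>j\<in>UNIV. (r' $ i * M t $ i $ j + M' $ i $ j * r t $ i) * s $ j)) (at t)"
    using assms unfolding has_matrix_derivative_def has_row_derivative_def
    by (intro DERIV_sum DERIV_cmult_right DERIV_mult) auto
  then show ?thesis
    by (simp add: row_col_sum sum.distrib algebra_simps)
qed

lemma tendsto_det:
  fixes M :: "'a \<Rightarrow> complex ^ 'n ^ 'n"
  assumes "\<And>i j. ((\<lambda>x. M x $ i $ j) \<longlongrightarrow> N $ i $ j) F"
  shows "((\<lambda>x. det (M x)) \<longlongrightarrow> det N) F"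
  unfolding det_def by (intro tendsto_intros assms)

text \<open>Column \<open>j\<close> of the inverse solves \<open>M *v x = axis j 1\<close>, so
  Cramer's rule applies. As a quotient of determinants, each entry of the inverse inherits
  continuity from the entries of \<open>M\<close>.\<close>

lemma matrix_inv_nth:
  fixes M :: "complex ^ 'n ^ 'n"
  assumes "det M \<noteq> 0"
  shows "matrix_inv M $ i $ j = det (\<chi> a b. if b = i then axis j 1 $ a else M $ a $ b) / det M"
proof -
  have "M *v (matrix_inv M *v axis j 1) = axis j 1"
    using matrix_inv_inverse(1)[OF assms] by (simp add: matrix_vector_mul_assoc)
  then have "matrix_inv M *v axis j 1
      = (\<chi> k. det (\<chi> a b. if b = k then axis j 1 $ a else M $ a $ b) / det M)"
    using cramer[OF assms] by blast
  moreover have "(matrix_inv M *v axis j 1) $ i = matrix_inv M $ i $ j"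
    by (simp add: matrix_vector_mult_def axis_def if_distrib cong: if_cong)
  ultimately show ?thesis
    by simp
qed

text \<open>The identity \<open>eq\<close> below turns the difference quotient of the inverse into
  minus the product of the inverse at \<open>x\<close>, the difference quotient of \<open>M\<close>,
  and the inverse at \<open>t\<close>. The limit then follows from the continuity
  \<open>inv_lim\<close> of the inverse.\<close>

lemma has_matrix_derivative_inv:
  fixes M :: "complex \<Rightarrow> complex ^ 'n ^ 'n"
  assumes der: "has_matrix_derivative M M' t" and nz: "det (M t) \<noteq> 0"
  shows "has_matrix_derivative (\<lambda>x. matrix_inv (M x)) (- (matrix_inv (M t) ** M' ** matrix_inv (M t))) t"
proof -
  have M_lim: "((\<lambda>x. M x $ i $ j) \<longlongrightarrow> M t $ i $ j) (at t)" for i j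
    using der unfolding has_matrix_derivative_def
    by (meson DERIV_isCont continuous_at)
  have det_lim: "((\<lambda>x. det (M x)) \<longlongrightarrow> det (M t)) (at t)"
    by (intro tendsto_det M_lim)
  then have ev: "eventually (\<lambda>x. det (M x) \<noteq> 0) (at t)"
    using nz by (rule tendsto_imp_eventually_ne)
  have inv_lim: "((\<lambda>x. matrix_inv (M x) $ i $ j) \<longlongrightarrow> matrix_inv (M t) $ i $ j) (at t)" for i j
  proof -
    have "((\<lambda>x. det (\<chi> a b. if b = i then axis j 1 $ a else M x $ a $ b) / det (M x)) \<longlongrightarrow>
        det (\<chi> a b. if b = i then axis j 1 $ a else M t $ a $ b) / det (M t)) (at t)"
      by (intro tendsto_divide tendsto_det det_lim nz) (simp add: M_lim)
    then show ?thesis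
      unfolding matrix_inv_nth[OF nz]
      by (rule Lim_transform_eventually) (use ev in \<open>eventually_elim; simp add: matrix_inv_nth\<close>)
  qed
  have eq: "matrix_inv (M x) - matrix_inv (M t) = - (matrix_inv (M x) ** (M x - M t) ** matrix_inv (M t))"
    if "det (M x) \<noteq> 0" for x
  proof -
    have "matrix_inv (M x) ** (M x - M t) ** matrix_inv (M t)
        = (matrix_inv (M x) ** M x) ** matrix_inv (M t) - matrix_inv (M x) ** (M t ** matrix_inv (M t))"
      by (simp add: matrix_ring_simps)
    also have "\<dots> = matrix_inv (M t) - matrix_inv (M x)"
      by (simp add: matrix_inv_inverse that nz)
    finally show ?thesis
      by simp
  qed
  show ?thesis
    unfolding has_matrix_derivative_def has_field_derivative_iff
  proof (intro allI)
    fix i j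
    have "((\<lambda>x. - (\<Sum>k\<in>UNIV. (\<Sum>l\<in>UNIV. matrix_inv (M x) $ i $ l
          * ((M x $ l $ k - M t $ l $ k) / (x - t))) * matrix_inv (M t) $ k $ j)) \<longlongrightarrow>
        - (\<Sum>k\<in>UNIV. (\<Sum>l\<in>UNIV. matrix_inv (M t) $ i $ l * M' $ l $ k)
          * matrix_inv (M t) $ k $ j)) (at t)"
      using der unfolding has_matrix_derivative_def has_field_derivative_iff
      by (intro tendsto_intros inv_lim) auto
    then have lim: "((\<lambda>x. - (\<Sum>k\<in>UNIV. (\<Sum>l\<in>UNIV. matrix_inv (M x) $ i $ l
          * ((M x $ l $ k - M t $ l $ k) / (x - t))) * matrix_inv (M t) $ k $ j)) \<longlongrightarrow>
        (- (matrix_inv (M t) ** M' ** matrix_inv (M t))) $ i $ j) (at t)"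
      by (simp add: matrix_matrix_mult_def)
    show "((\<lambda>x. (matrix_inv (M x) $ i $ j - matrix_inv (M t) $ i $ j) / (x - t)) \<longlongrightarrow>
        (- (matrix_inv (M t) ** M' ** matrix_inv (M t))) $ i $ j) (at t)"
    proof (rule Lim_transform_eventually[OF lim], use ev in eventually_elim)
      case (elim x)
      have "matrix_inv (M x) $ i $ j - matrix_inv (M t) $ i $ j
          = - (matrix_inv (M x) ** (M x - M t) ** matrix_inv (M t)) $ i $ j"
        using arg_cong[OF eq[OF elim], of "\<lambda>N. N $ i $ j"] by simp
      then show ?case
        by (simp add: matrix_matrix_mult_def sum_divide_distrib sum_distrib_right)
    qed
  qed
qed


subsection \<open>The Euler equations\<close>

text \<open>Since \<open>1 - w * wb = W * Wb\<close>, the momenta of the Lagrangian along the fields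
  are \<open>Q / Wb\<close> and \<open>P / Wb\<close>. The quotient rule and the first-order system
  then give exactly the derivatives of the Lagrangian in \<open>w\<close> and \<open>wb\<close>. The
  parameter \<sigma> is the sign of the potential term, so one statement serves both
  Lagrangians.\<close>

lemma euler_equations_of_first_order_system:
  fixes S :: "(complex \<times> complex) set" and w wb W Wb P Q :: "complex \<Rightarrow> complex \<Rightarrow> complex"
  assumes S: "open S" and in_S: "(\<xi>, \<eta>) \<in> S" and ne: "w \<xi> \<eta> * wb \<xi> \<eta> \<noteq> 1"
    and W_cont_x: "\<And>x y. (x, y) \<in> S \<Longrightarrow> isCont (\<lambda>x. W x y) x"
    and W_cont_y: "\<And>x y. (x, y) \<in> S \<Longrightarrow> isCont (\<lambda>y. W x y) y"
    and w_xi: "\<And>x y. (x, y) \<in> S \<Longrightarrow> ((\<lambda>x. w x y) has_field_derivative W x y * P x y) (at x)"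
    and wb_eta: "\<And>x y. (x, y) \<in> S \<Longrightarrow> ((\<lambda>y. wb x y) has_field_derivative W x y * Q x y) (at y)"
    and prod: "\<And>x y. (x, y) \<in> S \<Longrightarrow> 1 - w x y * wb x y = W x y * Wb x y"
    and Q_xi: "\<And>x y. (x, y) \<in> S \<Longrightarrow> ((\<lambda>x. Q x y) has_field_derivative \<sigma> * (wb x y * Wb x y)) (at x)"
    and Wb_xi: "\<And>x y. (x, y) \<in> S \<Longrightarrow> ((\<lambda>x. Wb x y) has_field_derivative - (wb x y * P x y)) (at x)"
    and P_eta: "\<And>x y. (x, y) \<in> S \<Longrightarrow> ((\<lambda>y. P x y) has_field_derivative \<sigma> * (w x y * Wb x y)) (at y)"
    and Wb_eta: "\<And>x y. (x, y) \<in> S \<Longrightarrow> ((\<lambda>y. Wb x y) has_field_derivative - (w x y * Q x y)) (at y)"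
  shows "euler_equations_at (\<lambda>w wb p q. p * q / (1 - w * wb) + \<sigma> * (w * wb)) w wb \<xi> \<eta>"
proof -
  define F :: lagrangian where "F = (\<lambda>w wb p q. p * q / (1 - w * wb) + \<sigma> * (w * wb))"
  have Fw: "((\<lambda>s. F s b p q) has_field_derivative p * q * b / (1 - a * b)\<^sup>2 + \<sigma> * b) (at a)"
    if "a * b \<noteq> 1" for a b p q
    unfolding F_def using that by (auto intro!: derivative_eq_intros simp: power2_eq_square)
  have Fwb: "((\<lambda>s. F a s p q) has_field_derivative p * q * a / (1 - a * b)\<^sup>2 + \<sigma> * a) (at b)"
    if "a * b \<noteq> 1" for a b p q
    unfolding F_def using that by (auto intro!: derivative_eq_intros simp: power2_eq_square)
  \<comment> \<open>\<open>F\<close> is affine in \<open>p\<close> and in \<open>q\<close> for all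
    \<open>a\<close>, \<open>b\<close>: if \<open>a * b = 1\<close>, the quotients are 0 by the
    convention for division by zero, and so are the stated derivatives.\<close>
  have Fp: "((\<lambda>s. F a b s q) has_field_derivative q / (1 - a * b)) (at p)" for a b p q
    unfolding F_def by (auto intro!: derivative_eq_intros simp: divide_inverse)
  have Fq: "((\<lambda>s. F a b p s) has_field_derivative p / (1 - a * b)) (at q)" for a b p q
    unfolding F_def by (auto intro!: derivative_eq_intros simp: divide_inverse)
  have dw: "d_xi w x y = W x y * P x y" and dwb: "d_eta wb x y = W x y * Q x y"
    if "(x, y) \<in> S" for x y
    using w_xi[OF that] wb_eta[OF that] by (auto simp: d_xi_def d_eta_def intro: DERIV_imp_deriv)
  have W0: "W \<xi> \<eta> \<noteq> 0" and Wb0: "Wb \<xi> \<eta> \<noteq> 0"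
    using prod[OF in_S] ne by auto
  have open_x: "open {x. (x, \<eta>) \<in> S}" and open_y: "open {y. (\<xi>, y) \<in> S}"
    using continuous_open_vimage[OF S, of "\<lambda>x. (x, \<eta>)"] continuous_open_vimage[OF S, of "\<lambda>y. (\<xi>, y)"]
    by (auto simp: vimage_def intro!: continuous_intros)
  have ev_x: "eventually (\<lambda>x. (x, \<eta>) \<in> S) (nhds \<xi>)" and ev_y: "eventually (\<lambda>y. (\<xi>, y) \<in> S) (nhds \<eta>)"
    using eventually_nhds_in_open[OF open_x] eventually_nhds_in_open[OF open_y] in_S by auto
  have along_p: "along (L_p F) w wb x y = Q x y / Wb x y"
    and along_q: "along (L_q F) w wb x y = P x y / Wb x y"
    if "(x, y) \<in> S" "W x y \<noteq> 0" for x y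
    using that unfolding along_def L_p_def L_q_def
    by (simp_all add: DERIV_imp_deriv[OF Fp] DERIV_imp_deriv[OF Fq] dw dwb prod)
  \<comment> \<open>The momentum is differentiated after replacing it by \<open>Q / Wb\<close>, so
    the replacement must hold in a neighbourhood. Continuity of \<open>W\<close> provides the
    non-vanishing used to cancel it there.\<close>
  have W_ev_x: "eventually (\<lambda>x. W x \<eta> \<noteq> 0) (nhds \<xi>)"
    using W_cont_x[OF in_S] W0 unfolding isCont_def
    by (simp add: eventually_nhds_conv_at tendsto_imp_eventually_ne)
  have W_ev_y: "eventually (\<lambda>y. W \<xi> y \<noteq> 0) (nhds \<eta>)"
    using W_cont_y[OF in_S] W0 unfolding isCont_def
    by (simp add: eventually_nhds_conv_at tendsto_imp_eventually_ne)
  have p_ev: "eventually (\<lambda>x. along (L_p F) w wb x \<eta> = Q x \<eta> / Wb x \<eta>) (nhds \<xi>)"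
    using ev_x W_ev_x by eventually_elim (rule along_p)
  have q_ev: "eventually (\<lambda>y. along (L_q F) w wb \<xi> y = P \<xi> y / Wb \<xi> y) (nhds \<eta>)"
    using ev_y W_ev_y by eventually_elim (rule along_q)
  let ?w = "w \<xi> \<eta>" and ?wb = "wb \<xi> \<eta>" and ?P = "P \<xi> \<eta>" and ?Q = "Q \<xi> \<eta>" and ?Wb = "Wb \<xi> \<eta>"
    and ?W = "W \<xi> \<eta>"
  have "((\<lambda>x. Q x \<eta> / Wb x \<eta>) has_field_derivative
      (\<sigma> * (?wb * ?Wb) * ?Wb - ?Q * - (?wb * ?P)) / (?Wb * ?Wb)) (at \<xi>)"
    by (rule DERIV_divide[OF Q_xi[OF in_S] Wb_xi[OF in_S] Wb0])
  also have "(\<sigma> * (?wb * ?Wb) * ?Wb - ?Q * - (?wb * ?P)) / (?Wb * ?Wb)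
      = (?W * ?P) * (?W * ?Q) * ?wb / (1 - ?w * ?wb)\<^sup>2 + \<sigma> * ?wb"
    unfolding prod[OF in_S] using W0 Wb0 by (simp add: field_simps power2_eq_square)
  also have "\<dots> = along (L_w F) w wb \<xi> \<eta>"
    unfolding along_def L_w_def by (simp add: DERIV_imp_deriv[OF Fw[OF ne]] dw dwb in_S)
  finally have p_der: "((\<lambda>x. along (L_p F) w wb x \<eta>) has_field_derivative along (L_w F) w wb \<xi> \<eta>) (at \<xi>)"
    using p_ev by (subst DERIV_cong_ev[OF refl _ refl])
  have "((\<lambda>y. P \<xi> y / Wb \<xi> y) has_field_derivative
      (\<sigma> * (?w * ?Wb) * ?Wb - ?P * - (?w * ?Q)) / (?Wb * ?Wb)) (at \<eta>)"
    by (rule DERIV_divide[OF P_eta[OF in_S] Wb_eta[OF in_S] Wb0])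
  also have "(\<sigma> * (?w * ?Wb) * ?Wb - ?P * - (?w * ?Q)) / (?Wb * ?Wb)
      = (?W * ?P) * (?W * ?Q) * ?w / (1 - ?w * ?wb)\<^sup>2 + \<sigma> * ?w"
    unfolding prod[OF in_S] using W0 Wb0 by (simp add: field_simps power2_eq_square)
  also have "\<dots> = along (L_wb F) w wb \<xi> \<eta>"
    unfolding along_def L_wb_def by (simp add: DERIV_imp_deriv[OF Fwb[OF ne]] dw dwb in_S)
  finally have q_der: "((\<lambda>y. along (L_q F) w wb \<xi> y) has_field_derivative along (L_wb F) w wb \<xi> \<eta>) (at \<eta>)"
    using q_ev by (subst DERIV_cong_ev[OF refl _ refl])
  have "has_partials_at F ?w ?wb (d_xi w \<xi> \<eta>) (d_eta wb \<xi> \<eta>)"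
    using Fw[OF ne] Fwb[OF ne] Fp Fq unfolding has_partials_at_def field_differentiable_def by blast
  then show ?thesis
    using p_der q_der w_xi[OF in_S] wb_eta[OF in_S]
    unfolding F_def[symmetric] euler_equations_at_def field_differentiable_def
    by (auto simp: d_xi_def[of "along _ _ _"] d_eta_def[of "along _ _ _"] DERIV_imp_deriv)
qed


subsection \<open>Resolvents of a product\<close>

text \<open>The right inverse is the one suggested by expanding both resolvents as geometric series.
  Taking determinants then shows that \<open>mat 1 + B ** A\<close> is invertible too.\<close>

lemma resolvent_intertwines:
  fixes A B :: "complex ^ 'n ^ 'n"
  assumes "det (mat 1 + A ** B) \<noteq> 0"
  shows "(mat 1 + B ** A) ** (mat 1 - B ** matrix_inv (mat 1 + A ** B) ** A) = mat 1"
proof -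
  let ?G = "matrix_inv (mat 1 + A ** B)"
  have "B ** ((mat 1 + A ** B) ** ?G) ** A = B ** A"
    by (simp add: matrix_inv_inverse(1)[OF assms])
  then have "B ** ?G ** A + B ** A ** B ** ?G ** A = B ** A"
    by (simp add: matrix_ring_simps)
  then show ?thesis
    by (simp add: matrix_ring_simps algebra_simps)
qed

lemma det_swap_ne_0:
  fixes A B :: "complex ^ 'n ^ 'n"
  assumes "det (mat 1 + A ** B) \<noteq> 0"
  shows "det (mat 1 + B ** A) \<noteq> 0"
  using arg_cong[OF resolvent_intertwines[OF assms], of det] by (auto simp: det_mul)

text \<open>The identity \<open>A ** (mat 1 + B ** A) = (mat 1 + A ** B) ** A\<close>, multiplied by
  the two inverses from either side.\<close>

lemma resolvent_mult:
  fixes A B :: "complex ^ 'n ^ 'n"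
  assumes "det (mat 1 + A ** B) \<noteq> 0"
  shows "matrix_inv (mat 1 + A ** B) ** A = A ** matrix_inv (mat 1 + B ** A)"
proof -
  let ?G = "matrix_inv (mat 1 + A ** B)" and ?H = "matrix_inv (mat 1 + B ** A)"
  have "?G ** A = ?G ** (A ** (mat 1 + B ** A)) ** ?H"
    using matrix_inv_inverse(1)[OF det_swap_ne_0[OF assms]] by (simp add: matrix_mul_assoc[symmetric])
  also have "A ** (mat 1 + B ** A) = (mat 1 + A ** B) ** A"
    by (simp add: matrix_ring_simps)
  also have "?G ** ((mat 1 + A ** B) ** A) ** ?H = A ** ?H"
    using matrix_inv_inverse(2)[OF assms] by (simp add: matrix_mul_assoc)
  finally show ?thesis .
qed

text \<open>
  For a fixed value of the other variable, \<open>T = L\<inverse>\<close>, \<open>Tb = Lb\<inverse>\<close> for the variable \<open>\<xi>\<close>, and \<open>T = - L\<close>, \<open>Tb = - Lb\<close> for \<open>\<eta>\<close>.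
  The row \<open>r\<close> is \<open>ab\<close> or \<open>ab Lb\<inverse>\<close>.
\<close>

locale cauchy_flow =
  fixes A B :: "complex \<Rightarrow> complex ^ 'n ^ 'n" and r :: "complex \<Rightarrow> complex ^ 'n"
    and T Tb :: "complex ^ 'n ^ 'n" and t :: complex
  assumes dA: "has_matrix_derivative A (A t ** T) t"
    and dB: "has_matrix_derivative B (- (B t ** Tb)) t"
    and dr: "has_row_derivative r (- (r t v* Tb)) t"
    and det_ne_0: "det (mat 1 + A t ** B t) \<noteq> 0"
begin

abbreviation "G \<equiv> \<lambda>x. matrix_inv (mat 1 + A x ** B x)"

lemma G_derivative:
  "has_matrix_derivative G (- (G t ** (A t ** T ** B t - A t ** B t ** Tb) ** G t)) t"
proof -
  have "has_matrix_derivative (\<lambda>x. mat 1 + A x ** B x) (A t ** T ** B t + A t ** (- (B t ** Tb))) t"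
    by (intro has_matrix_derivative_add_const has_matrix_derivative_mult dA dB)
  from has_matrix_derivative_inv[OF this det_ne_0] show ?thesis
    by (simp add: matrix_ring_simps)
qed

lemma G_cancel: "G t ** (A t ** B t) = mat 1 - G t" "A t ** B t ** G t = mat 1 - G t"
  using matrix_inv_inverse[OF det_ne_0] by (simp_all add: matrix_ring_simps algebra_simps)

text \<open>The derivative of \<open>G\<close> contains the commutator of \<open>B\<close> between
  \<open>G ** A\<close> and \<open>G\<close>, and its rank one gives the product. Here
  \<open>Tb\<close> stays next to the row; in \<open>G_derivative_left\<close> it ends up next to
  the column.\<close>

lemma G_derivative_right:
  assumes "B t ** Tb - T ** B t = col_row p q"
  shows "((\<lambda>x. row_col (r x) (G x *v s)) has_field_derivative
    - row_col (r t) ((Tb ** G t) *v s)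
    + row_col (r t) ((G t ** A t) *v p) * row_col q (G t *v s)) (at t)"
proof -
  have "A t ** T ** B t - A t ** B t ** Tb = - (A t ** (B t ** Tb - T ** B t))"
    by (simp add: matrix_ring_simps)
  then have "- (G t ** (A t ** T ** B t - A t ** B t ** Tb) ** G t) = G t ** A t ** col_row p q ** G t"
    unfolding assms by (simp add: matrix_ring_simps)
  then show ?thesis
    using has_field_derivative_row_col[OF dr G_derivative, of s]
    by (simp add: row_col_minus_left row_col_vector_matrix row_col_col_row matrix_vector_mul_assoc)
qed

text \<open>The first summand comes from differentiating the row. Absorbing it with
  \<open>G ** A ** B = mat 1 - G\<close> prepares for the commutator of \<open>A\<close> instead of
  that of \<open>B\<close>.\<close>

lemma G_derivative_sum:
  "- (Tb ** G t) - G t ** (A t ** T ** B t - A t ** B t ** Tb) ** G t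
    = - (G t ** Tb ** G t) - G t ** A t ** T ** B t ** G t"
proof -
  have "(G t ** (A t ** B t)) ** Tb ** G t = Tb ** G t - G t ** Tb ** G t"
    unfolding G_cancel by (simp add: matrix_ring_simps)
  then show ?thesis
    by (simp add: matrix_ring_simps)
qed

text \<open>Placing the commutator of \<open>A\<close> between \<open>G\<close> and
  \<open>B ** G\<close> and using \<open>A ** B ** G = mat 1 - G\<close> reproduces the expression
  of \<open>G_derivative_sum\<close> up to the single term \<open>G ** Tb\<close>.\<close>

lemma G_derivative_left:
  assumes "A t ** T - Tb ** A t = col_row p q"
  shows "((\<lambda>x. row_col (r x) (G x *v s)) has_field_derivative
    - row_col (r t) ((G t ** Tb) *v s)
    - row_col (r t) (G t *v p) * row_col q ((B t ** G t) *v s)) (at t)"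
proof -
  have "G t ** (A t ** T - Tb ** A t) ** (B t ** G t)
      = G t ** A t ** T ** B t ** G t - G t ** Tb ** (A t ** B t ** G t)"
    by (simp add: matrix_ring_simps)
  also have "\<dots> = G t ** A t ** T ** B t ** G t - G t ** Tb + G t ** Tb ** G t"
    unfolding G_cancel by (simp add: matrix_ring_simps)
  finally have "- (Tb ** G t) - G t ** (A t ** T ** B t - A t ** B t ** Tb) ** G t
      = - (G t ** Tb) - G t ** col_row p q ** (B t ** G t)"
    unfolding G_derivative_sum assms by (simp add: algebra_simps)
  from arg_cong[OF this, of "\<lambda>M. row_col (r t) (M *v s)"] show ?thesis
    using has_field_derivative_row_col[OF dr G_derivative, of s]
    by (simp add: row_col_minus_left row_col_vector_matrix row_col_col_row matrix_vector_mul_assoc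
        row_col_linear)
qed

text \<open>All contributions combine into the commutator of \<open>A\<close> between the two
  resolvents, so the derivative is a single product of scalars.\<close>

lemma GA_derivative:
  assumes "A t ** T - Tb ** A t = col_row p q"
  shows "((\<lambda>x. row_col (r x) ((G x ** A x) *v s)) has_field_derivative
    row_col (r t) (G t *v p) * row_col q (matrix_inv (mat 1 + B t ** A t) *v s)) (at t)"
proof -
  let ?H = "matrix_inv (mat 1 + B t ** A t)"
  have GA: "G t ** A t = A t ** ?H"
    by (rule resolvent_mult[OF det_ne_0])
  \<comment> \<open>Inserting \<open>(mat 1 + B t ** A t) ** ?H\<close> splits off a summand that
    cancels the term with \<open>T ** B\<close> in \<open>G_derivative_sum\<close>.\<close>
  have "G t ** A t ** T = G t ** A t ** T ** ((mat 1 + B t ** A t) ** ?H)"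
    by (simp add: matrix_inv_inverse(1)[OF det_swap_ne_0[OF det_ne_0]])
  also have "\<dots> = G t ** A t ** T ** ?H + G t ** A t ** T ** B t ** (A t ** ?H)"
    by (simp add: matrix_ring_simps)
  finally have *: "G t ** A t ** T = G t ** A t ** T ** ?H + G t ** A t ** T ** B t ** (G t ** A t)"
    unfolding GA .
  have "(- (Tb ** G t) - G t ** (A t ** T ** B t - A t ** B t ** Tb) ** G t) ** A t + G t ** A t ** T
      = - (G t ** Tb ** (G t ** A t)) - G t ** A t ** T ** B t ** (G t ** A t) + G t ** A t ** T"
    unfolding G_derivative_sum by (simp add: matrix_ring_simps)
  also have "\<dots> = G t ** (A t ** T - Tb ** A t) ** ?H"
    by (subst (2) *) (simp add: GA matrix_ring_simps)
  finally have "- (Tb ** G t ** A t)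
      + (- (G t ** (A t ** T ** B t - A t ** B t ** Tb) ** G t) ** A t + G t ** (A t ** T))
      = G t ** col_row p q ** ?H"
    unfolding assms by (simp add: matrix_ring_simps algebra_simps)
  from arg_cong[OF this, of "\<lambda>M. row_col (r t) (M *v s)"] show ?thesis
    using has_field_derivative_row_col[OF dr has_matrix_derivative_mult[OF G_derivative dA], of s]
    by (simp add: row_col_minus_left row_col_vector_matrix row_col_col_row matrix_vector_mul_assoc
        row_col_linear matrix_mul_assoc)
qed

end


section \<open>Symmetry of a scaled resolvent\<close>

lemma transpose_diag: "transpose (diag d) = diag d"
  by (simp add: transpose_def diag_def vec_eq_iff)

lemma diag_commute: "diag d ** diag e = diag e ** diag d"
  by (simp add: diag_mult_diag mult.commute)

lemma transpose_add: "transpose (A + B) = transpose A + transpose B"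
  by (simp add: transpose_def vec_eq_iff)

text \<open>If \<open>d\<close> and \<open>e\<close> have no zero entries, the inverse of
  \<open>X\<close> is the inverse of \<open>diag e ** diag d\<close> minus \<open>S\<close>, which
  is symmetric. Zero entries are allowed here, so \<open>X\<close> may be singular. Instead,
  \<open>X ** S ** transpose X\<close> is expanded once through its left and once through its right
  factor; comparison gives \<open>X ** S ** ?E = ?E ** S ** transpose X\<close>.\<close>

lemma scaled_resolvent_symmetric:
  fixes S :: "complex ^ 'n ^ 'n"
  assumes S: "transpose S = S" and D: "det (mat 1 - diag d ** S ** diag e) \<noteq> 0"
  defines "X \<equiv> diag e ** matrix_inv (mat 1 - diag d ** S ** diag e) ** diag d"
  shows "transpose X = X"
proof -
  let ?G = "matrix_inv (mat 1 - diag d ** S ** diag e)" and ?E = "diag e ** diag d"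
  have E: "transpose ?E = ?E"
    by (simp add: matrix_transpose_mul transpose_diag diag_commute)
  have 1: "?G = mat 1 + ?G ** diag d ** S ** diag e"
    using matrix_inv_inverse(2)[OF D] by (simp add: matrix_ring_simps algebra_simps)
  have 2: "?G = mat 1 + diag d ** S ** diag e ** ?G"
    using matrix_inv_inverse(1)[OF D] by (simp add: matrix_ring_simps algebra_simps)
  have X1: "X = ?E + X ** S ** ?E"
    unfolding X_def by (subst 1) (simp add: matrix_ring_simps)
  have X2: "X = ?E + ?E ** S ** X"
    unfolding X_def by (subst 2) (simp add: matrix_ring_simps)
  have XT: "transpose X = ?E + ?E ** S ** transpose X"
    by (subst X1) (simp add: transpose_add matrix_transpose_mul transpose_diag diag_commute S matrix_mul_assoc)
  have "X ** S ** transpose X = X ** S ** ?E + X ** S ** ?E ** S ** transpose X"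
    by (subst XT) (simp add: matrix_ring_simps)
  moreover have "X ** S ** transpose X = ?E ** S ** transpose X + X ** S ** ?E ** S ** transpose X"
    by (subst X1) (simp add: matrix_ring_simps)
  ultimately have "X ** S ** ?E = ?E ** S ** transpose X"
    by simp
  then show ?thesis
    using X1 XT by simp
qed

subsection \<open>The auxiliary fields\<close>

definition phib_fun :: "complex ^ 'n \<Rightarrow> complex ^ 'n \<Rightarrow> complex ^ 'n \<Rightarrow> complex ^ 'n
    \<Rightarrow> complex ^ 'n \<Rightarrow> complex ^ 'n \<Rightarrow> complex \<Rightarrow> complex \<Rightarrow> complex"
  where "phib_fun L Lb \<alpha> \<alpha>b c cb \<xi> \<eta> =
    - row_col (ab_row Lb cb \<xi> \<eta> v* matrix_inv (diag Lb)) (G_mat L Lb \<alpha> \<alpha>b c cb \<xi> \<eta> *v beta_col Lb \<alpha>)"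

definition psi_fun :: "complex ^ 'n \<Rightarrow> complex ^ 'n \<Rightarrow> complex ^ 'n \<Rightarrow> complex ^ 'n
    \<Rightarrow> complex ^ 'n \<Rightarrow> complex ^ 'n \<Rightarrow> complex \<Rightarrow> complex \<Rightarrow> complex"
  where "psi_fun L Lb \<alpha> \<alpha>b c cb \<xi> \<eta> =
    - row_col (ab_row Lb cb \<xi> \<eta>) (G_mat L Lb \<alpha> \<alpha>b c cb \<xi> \<eta> *v \<alpha>)"

definition phi_fun :: "complex ^ 'n \<Rightarrow> complex ^ 'n \<Rightarrow> complex ^ 'n \<Rightarrow> complex ^ 'n
    \<Rightarrow> complex ^ 'n \<Rightarrow> complex ^ 'n \<Rightarrow> complex \<Rightarrow> complex \<Rightarrow> complex"
  where "phi_fun L Lb \<alpha> \<alpha>b c cb \<xi> \<eta> =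
    - row_col (a_row L c \<xi> \<eta> v* matrix_inv (diag L)) (Gb_mat L Lb \<alpha> \<alpha>b c cb \<xi> \<eta> *v betab_col L \<alpha>b)"

definition psib_fun :: "complex ^ 'n \<Rightarrow> complex ^ 'n \<Rightarrow> complex ^ 'n \<Rightarrow> complex ^ 'n
    \<Rightarrow> complex ^ 'n \<Rightarrow> complex ^ 'n \<Rightarrow> complex \<Rightarrow> complex \<Rightarrow> complex"
  where "psib_fun L Lb \<alpha> \<alpha>b c cb \<xi> \<eta> =
    - row_col (a_row L c \<xi> \<eta>) (Gb_mat L Lb \<alpha> \<alpha>b c cb \<xi> \<eta> *v \<alpha>b)"

text \<open>
  Exchanging barred and unbarred data together with \<open>(\<xi>, \<eta>) \<mapsto> (- \<xi>, - \<eta>)\<close> is a symmetry, so each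
  equation below needs to be proved for only one of its two versions.
\<close>

lemma mat_minus: "mat (- x) = - (mat x :: complex ^ 'n ^ 'n)"
  by (simp add: mat_def vec_eq_iff)

lemma bar_expo: "expo L (- \<xi>) (- \<eta>) = expob L \<xi> \<eta>" "expob L (- \<xi>) (- \<eta>) = expo L \<xi> \<eta>"
  by (simp_all add: expo_def expob_def mat_minus matrix_mul_minus_left)

lemma bar_swap:
  "a_row L c (- \<xi>) (- \<eta>) = ab_row L c \<xi> \<eta>"
  "ab_row Lb cb (- \<xi>) (- \<eta>) = a_row Lb cb \<xi> \<eta>"
  "A_mat Lb L \<alpha>b cb (- \<xi>) (- \<eta>) = Ab_mat L Lb \<alpha>b cb \<xi> \<eta>"
  "Ab_mat Lb L \<alpha> c (- \<xi>) (- \<eta>) = A_mat L Lb \<alpha> c \<xi> \<eta>"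
  "G_mat Lb L \<alpha>b \<alpha> cb c (- \<xi>) (- \<eta>) = Gb_mat L Lb \<alpha> \<alpha>b c cb \<xi> \<eta>"
  "Gb_mat Lb L \<alpha>b \<alpha> cb c (- \<xi>) (- \<eta>) = G_mat L Lb \<alpha> \<alpha>b c cb \<xi> \<eta>"
  by (simp_all add: a_row_def ab_row_def A_mat_def Ab_mat_def G_mat_def Gb_mat_def bar_expo)

lemma bar_swap_fun:
  "u_fun Lb L \<alpha>b \<alpha> cb c (- \<xi>) (- \<eta>) = ub_fun L Lb \<alpha> \<alpha>b c cb \<xi> \<eta>"
  "v_fun Lb L \<alpha>b \<alpha> cb c (- \<xi>) (- \<eta>) = vb_fun L Lb \<alpha> \<alpha>b c cb \<xi> \<eta>"
  "ub_fun Lb L \<alpha>b \<alpha> cb c (- \<xi>) (- \<eta>) = u_fun L Lb \<alpha> \<alpha>b c cb \<xi> \<eta>"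
  "vb_fun Lb L \<alpha>b \<alpha> cb c (- \<xi>) (- \<eta>) = v_fun L Lb \<alpha> \<alpha>b c cb \<xi> \<eta>"
  "phib_fun Lb L \<alpha>b \<alpha> cb c (- \<xi>) (- \<eta>) = phi_fun L Lb \<alpha> \<alpha>b c cb \<xi> \<eta>"
  "psi_fun Lb L \<alpha>b \<alpha> cb c (- \<xi>) (- \<eta>) = psib_fun L Lb \<alpha> \<alpha>b c cb \<xi> \<eta>"
  "phi_fun Lb L \<alpha>b \<alpha> cb c (- \<xi>) (- \<eta>) = phib_fun L Lb \<alpha> \<alpha>b c cb \<xi> \<eta>"
  by (simp_all add: u_fun_def v_fun_def ub_fun_def vb_fun_def phib_fun_def psi_fun_def phi_fun_def
      psib_fun_def bar_swap beta_col_def betab_col_def)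

section \<open>The soliton data, their Sylvester identities and flows\<close>

locale soliton =
  fixes L Lb \<alpha> \<alpha>b c cb :: "complex ^ 'n"
  assumes L: "\<And>j. L $ j \<noteq> 0" and Lb: "\<And>j. Lb $ j \<noteq> 0" and L_Lb: "\<And>j k. L $ j \<noteq> Lb $ k"
begin

abbreviation "A \<equiv> A_mat L Lb \<alpha> c"
abbreviation "B \<equiv> Ab_mat L Lb \<alpha>b cb"
abbreviation "G \<equiv> G_mat L Lb \<alpha> \<alpha>b c cb"
abbreviation "Gb \<equiv> Gb_mat L Lb \<alpha> \<alpha>b c cb"
abbreviation "a \<equiv> a_row L c"
abbreviation "ab \<equiv> ab_row Lb cb"
abbreviation "Li \<equiv> matrix_inv (diag L)"
abbreviation "Lbi \<equiv> matrix_inv (diag Lb)"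
abbreviation "\<beta> \<equiv> beta_col Lb \<alpha>"
abbreviation "\<beta>b \<equiv> betab_col L \<alpha>b"
abbreviation "u \<equiv> u_fun L Lb \<alpha> \<alpha>b c cb"
abbreviation "v \<equiv> v_fun L Lb \<alpha> \<alpha>b c cb"
abbreviation "ub \<equiv> ub_fun L Lb \<alpha> \<alpha>b c cb"
abbreviation "vb \<equiv> vb_fun L Lb \<alpha> \<alpha>b c cb"
abbreviation "\<phi> \<equiv> phi_fun L Lb \<alpha> \<alpha>b c cb"
abbreviation "\<psi> \<equiv> psi_fun L Lb \<alpha> \<alpha>b c cb"
abbreviation "\<phi>b \<equiv> phib_fun L Lb \<alpha> \<alpha>b c cb"
abbreviation "\<psi>b \<equiv> psib_fun L Lb \<alpha> \<alpha>b c cb"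
abbreviation "\<Omega> \<equiv> Omega L Lb \<alpha> \<alpha>b c cb"

lemma Li: "Li = diag (\<chi> j. 1 / L $ j)" and Lbi: "Lbi = diag (\<chi> j. 1 / Lb $ j)"
  by (rule matrix_inv_diag, fact L) (rule matrix_inv_diag, fact Lb)

lemma Li_inverse: "Li ** diag L = mat 1" "diag L ** Li = mat 1"
  and Lbi_inverse: "Lbi ** diag Lb = mat 1" "diag Lb ** Lbi = mat 1"
  unfolding Li Lbi by (simp_all add: diag_mult_diag mat_eq_diag L Lb)

lemma Omega_iff: "(\<xi>, \<eta>) \<in> \<Omega> \<longleftrightarrow> det (mat 1 + A \<xi> \<eta> ** B \<xi> \<eta>) \<noteq> 0"
  by (simp add: Omega_def)

lemma a_nth: "a \<xi> \<eta> $ k = c $ k * exp (\<xi> / L $ k - \<eta> * L $ k)"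
  by (simp add: a_row_def expo_eq L vec_mult_diag_nth)

lemma ab_nth: "ab \<xi> \<eta> $ k = cb $ k * exp (- \<xi> / Lb $ k + \<eta> * Lb $ k)"
  by (simp add: ab_row_def expob_eq Lb vec_mult_diag_nth)

lemma A_nth: "A \<xi> \<eta> $ j $ k = \<alpha> $ j * a \<xi> \<eta> $ k / (Lb $ j - L $ k)"
  by (simp add: A_mat_def a_nth expo_eq L mult_diag_nth)

lemma B_nth: "B \<xi> \<eta> $ j $ k = \<alpha>b $ j * ab \<xi> \<eta> $ k / (L $ j - Lb $ k)"
  by (simp add: Ab_mat_def ab_nth expob_eq Lb mult_diag_nth)

text \<open>The signs give the shapes \<open>A ** T - Tb ** A\<close> and
  \<open>B ** Tb - T ** B\<close> for the \<eta>-flow, where \<open>T = - diag L\<close> and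
  \<open>Tb = - diag Lb\<close>.\<close>

lemma Sylvester: "A \<xi> \<eta> ** - diag L - - diag Lb ** A \<xi> \<eta> = col_row \<alpha> (a \<xi> \<eta>)"
  and Sylvester_bar: "B \<xi> \<eta> ** - diag Lb - - diag L ** B \<xi> \<eta> = col_row \<alpha>b (ab \<xi> \<eta>)"
  using A_mat_Sylvester[OF L L_Lb, of \<alpha> c \<xi> \<eta>] Ab_mat_Sylvester[OF Lb L_Lb, of \<alpha>b cb \<xi> \<eta>]
  by (simp_all add: matrix_ring_simps)

text \<open>Multiplying the Sylvester identities by the inverse diagonal matrices on both sides
  gives the commutators for the \<xi>-flow and turns \<alpha> into \<beta>.\<close>

lemma Sylvester_inverse: "A \<xi> \<eta> ** Li - Lbi ** A \<xi> \<eta> = col_row \<beta> (a \<xi> \<eta> v* Li)"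
  and Sylvester_bar_inverse: "B \<xi> \<eta> ** Lbi - Li ** B \<xi> \<eta> = col_row \<beta>b (ab \<xi> \<eta> v* Lbi)"
proof -
  have "Lbi ** (diag Lb ** A \<xi> \<eta> - A \<xi> \<eta> ** diag L) ** Li
      = (Lbi ** diag Lb) ** A \<xi> \<eta> ** Li - Lbi ** A \<xi> \<eta> ** (diag L ** Li)"
    by (simp add: matrix_ring_simps)
  then show "A \<xi> \<eta> ** Li - Lbi ** A \<xi> \<eta> = col_row \<beta> (a \<xi> \<eta> v* Li)"
    unfolding A_mat_Sylvester[OF L L_Lb] col_row_mult Li_inverse Lbi_inverse
    by (simp add: beta_col_def)
  have "Li ** (diag L ** B \<xi> \<eta> - B \<xi> \<eta> ** diag Lb) ** Lbi
      = (Li ** diag L) ** B \<xi> \<eta> ** Lbi - Li ** B \<xi> \<eta> ** (diag Lb ** Lbi)"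
    by (simp add: matrix_ring_simps)
  then show "B \<xi> \<eta> ** Lbi - Li ** B \<xi> \<eta> = col_row \<beta>b (ab \<xi> \<eta> v* Lbi)"
    unfolding Ab_mat_Sylvester[OF Lb L_Lb] col_row_mult Li_inverse Lbi_inverse
    by (simp add: betab_col_def)
qed

lemma a_nth_xi: "((\<lambda>x. a x \<eta> $ k) has_field_derivative a \<xi> \<eta> $ k * (1 / L $ k)) (at \<xi>)"
  and a_nth_eta: "((\<lambda>y. a \<xi> y $ k) has_field_derivative - (a \<xi> \<eta> $ k * L $ k)) (at \<eta>)"
  unfolding a_nth using L by (auto intro!: derivative_eq_intros)

lemma ab_nth_xi: "((\<lambda>x. ab x \<eta> $ k) has_field_derivative - (ab \<xi> \<eta> $ k * (1 / Lb $ k))) (at \<xi>)"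
  and ab_nth_eta: "((\<lambda>y. ab \<xi> y $ k) has_field_derivative ab \<xi> \<eta> $ k * Lb $ k) (at \<eta>)"
  unfolding ab_nth using Lb by (auto intro!: derivative_eq_intros)

lemma flow_xi:
  assumes "(\<xi>, \<eta>) \<in> \<Omega>" "has_row_derivative r (- (r \<xi> v* Lbi)) \<xi>"
  shows "cauchy_flow (\<lambda>x. A x \<eta>) (\<lambda>x. B x \<eta>) r Li Lbi \<xi>"
proof
  show "has_matrix_derivative (\<lambda>x. A x \<eta>) (A \<xi> \<eta> ** Li) \<xi>"
    unfolding has_matrix_derivative_def Li mult_diag_nth A_nth
    using DERIV_cmult[OF a_nth_xi, of "\<alpha> $ j / (Lb $ j - L $ k)" for j k] by simp
  show "has_matrix_derivative (\<lambda>x. B x \<eta>) (- (B \<xi> \<eta> ** Lbi)) \<xi>"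
    unfolding has_matrix_derivative_def Lbi vector_uminus_component mult_diag_nth B_nth
    using DERIV_cmult[OF ab_nth_xi, of "\<alpha>b $ j / (L $ j - Lb $ k)" for j k] by (simp add: mult.assoc)
qed (use assms Omega_iff in auto)

lemma flow_eta:
  assumes "(\<xi>, \<eta>) \<in> \<Omega>" "has_row_derivative r (- (r \<eta> v* - diag Lb)) \<eta>"
  shows "cauchy_flow (\<lambda>y. A \<xi> y) (\<lambda>y. B \<xi> y) r (- diag L) (- diag Lb) \<eta>"
proof
  show "has_matrix_derivative (\<lambda>y. A \<xi> y) (A \<xi> \<eta> ** - diag L) \<eta>"
    unfolding has_matrix_derivative_def matrix_mul_minus_right vector_uminus_component mult_diag_nth A_nth
    using DERIV_cmult[OF a_nth_eta, of "\<alpha> $ j / (Lb $ j - L $ k)" for j k] by (simp add: mult.assoc)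
  show "has_matrix_derivative (\<lambda>y. B \<xi> y) (- (B \<xi> \<eta> ** - diag Lb)) \<eta>"
    unfolding has_matrix_derivative_def matrix_mul_minus_right minus_minus mult_diag_nth B_nth
    using DERIV_cmult[OF ab_nth_eta, of "\<alpha>b $ j / (L $ j - Lb $ k)" for j k] by (simp add: mult.assoc)
qed (use assms Omega_iff in auto)

lemma ab_xi: "has_row_derivative (\<lambda>x. ab x \<eta>) (- (ab \<xi> \<eta> v* Lbi)) \<xi>"
  unfolding has_row_derivative_def Lbi vector_uminus_component vec_mult_diag_nth
  using ab_nth_xi by simp

lemma ab_eta: "has_row_derivative (\<lambda>y. ab \<xi> y) (- (ab \<xi> \<eta> v* - diag Lb)) \<eta>"
  unfolding has_row_derivative_def vec_mult_minus_diag vec_mult_diag_nth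
  using ab_nth_eta by simp

lemma ab_Lbi_eta:
  "has_row_derivative (\<lambda>y. ab \<xi> y v* Lbi) (- ((ab \<xi> \<eta> v* Lbi) v* - diag Lb)) \<eta>"
  unfolding has_row_derivative_def vec_mult_minus_diag Lbi vec_mult_diag_nth
  by (intro allI DERIV_cong[OF DERIV_cmult_right[OF ab_nth_eta]]) simp

text \<open>
  Both formulas are obtained by transposing the scalars in the definitions of \<open>u\<close> and \<open>v\<close>, since
  \<open>A ** B = - (diag \<alpha> ** S ** diag ab)\<close> with \<open>S\<close> symmetric.
\<close>

lemma u_alt: "u \<xi> \<eta> = 1 + row_col (a \<xi> \<eta> v* Li) ((B \<xi> \<eta> ** G \<xi> \<eta>) *v \<alpha>)"
  and v_alt: "v \<xi> \<eta> = row_col (ab \<xi> \<eta> v* Lbi) (G \<xi> \<eta> *v \<alpha>)"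
  if "(\<xi>, \<eta>) \<in> \<Omega>" for \<xi> \<eta>
proof -
  \<comment> \<open>The entries of \<open>A ** B\<close> with \<alpha> taken out on the left and
    \<open>ab\<close> on the right. The sign extracted by \<open>neg\<close> makes both Cauchy
    denominators have the same form, whence the symmetry.\<close>
  define S :: "complex ^ 'n ^ 'n" where
    "S = (\<chi> i j. \<Sum>k\<in>UNIV. a \<xi> \<eta> $ k * \<alpha>b $ k / ((Lb $ i - L $ k) * (Lb $ j - L $ k)))"
  have neg: "L $ k - Lb $ j = - (Lb $ j - L $ k)" for j k
    by simp
  have AB: "mat 1 + A \<xi> \<eta> ** B \<xi> \<eta> = mat 1 - diag \<alpha> ** S ** diag (ab \<xi> \<eta>)"
    by (simp add: vec_eq_iff mult_diag_nth diag_mult_nth S_def)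
       (simp add: matrix_matrix_mult_def A_nth B_nth sum_distrib_left sum_distrib_right neg
         sum_negf[symmetric] mult_ac del: minus_diff_eq)
  have "transpose S = S"
    by (simp add: S_def transpose_def vec_eq_iff mult_ac)
  then have "transpose (diag (ab \<xi> \<eta>) ** G \<xi> \<eta> ** diag \<alpha>) = diag (ab \<xi> \<eta>) ** G \<xi> \<eta> ** diag \<alpha>"
    using scaled_resolvent_symmetric[of S \<alpha> "ab \<xi> \<eta>"] that
    by (simp add: G_mat_def AB Omega_iff)
  then have sym: "ab \<xi> \<eta> $ i * G \<xi> \<eta> $ i $ j * \<alpha> $ j = ab \<xi> \<eta> $ j * G \<xi> \<eta> $ j $ i * \<alpha> $ i" for i j
    unfolding vec_eq_iff transpose_def by (simp add: mult_diag_nth diag_mult_nth)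
  show "v \<xi> \<eta> = row_col (ab \<xi> \<eta> v* Lbi) (G \<xi> \<eta> *v \<alpha>)"
  proof -
    have "v \<xi> \<eta> = (\<Sum>i\<in>UNIV. \<Sum>j\<in>UNIV. (ab \<xi> \<eta> $ i * G \<xi> \<eta> $ i $ j * \<alpha> $ j) / Lb $ j)"
      unfolding v_fun_def beta_col_def matrix_vector_mul_assoc Lbi row_col_sum
      by (simp add: mult_diag_nth)
    also have "\<dots> = (\<Sum>i\<in>UNIV. \<Sum>j\<in>UNIV. (ab \<xi> \<eta> $ j * G \<xi> \<eta> $ j $ i * \<alpha> $ i) / Lb $ j)"
      by (simp only: sym)
    also have "\<dots> = row_col (ab \<xi> \<eta> v* Lbi) (G \<xi> \<eta> *v \<alpha>)"
      unfolding row_col_sum Lbi by (subst sum.swap) (simp add: vec_mult_diag_nth)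
    finally show ?thesis .
  qed
  show "u \<xi> \<eta> = 1 + row_col (a \<xi> \<eta> v* Li) ((B \<xi> \<eta> ** G \<xi> \<eta>) *v \<alpha>)"
  proof -
    \<comment> \<open>Apart from the factor \<alpha>, this is an entry of \<open>A\<close> times an
      entry of \<beta>b. After the exchange by \<open>sym\<close> it meets \<open>ab $ j\<close>,
      and the product is \<open>- (a $ k / L $ k) * B $ k $ j\<close>; hence the change of
      sign.\<close>
    let ?c = "\<lambda>k j. a \<xi> \<eta> $ k * \<alpha>b $ k / (L $ k * (Lb $ j - L $ k))"
    have "u \<xi> \<eta> = 1 - (\<Sum>i\<in>UNIV. \<Sum>k\<in>UNIV. \<Sum>j\<in>UNIV.
        (ab \<xi> \<eta> $ i * G \<xi> \<eta> $ i $ j * \<alpha> $ j) * ?c k j)"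
      unfolding u_fun_def betab_col_def matrix_vector_mul_assoc Li row_col_sum
      by (simp add: mult_diag_nth)
         (simp add: matrix_matrix_mult_def A_nth sum_distrib_left sum_distrib_right
           sum_divide_distrib mult_ac)
    also have "\<dots> = 1 - (\<Sum>i\<in>UNIV. \<Sum>k\<in>UNIV. \<Sum>j\<in>UNIV.
        (ab \<xi> \<eta> $ j * G \<xi> \<eta> $ j $ i * \<alpha> $ i) * ?c k j)"
      by (simp only: sym)
    also have "\<dots> = 1 + row_col (a \<xi> \<eta> v* Li) ((B \<xi> \<eta> ** G \<xi> \<eta>) *v \<alpha>)"
      unfolding row_col_sum Li
      by (subst sum.swap) (simp add: vec_mult_diag_nth matrix_matrix_mult_def B_nth neg
         sum_distrib_left sum_distrib_right sum_divide_distrib sum_negf[symmetric] mult_ac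
         del: minus_diff_eq)
    finally show ?thesis .
  qed
qed

section \<open>The first-order system and the quadratic relation\<close>

lemma Gb_mult_B: "Gb \<xi> \<eta> ** B \<xi> \<eta> = B \<xi> \<eta> ** G \<xi> \<eta>" if "(\<xi>, \<eta>) \<in> \<Omega>"
  using resolvent_mult[OF det_swap_ne_0] that unfolding Omega_iff Gb_mat_def G_mat_def .

lemma G_mult_A: "G \<xi> \<eta> ** A \<xi> \<eta> = A \<xi> \<eta> ** Gb \<xi> \<eta>" if "(\<xi>, \<eta>) \<in> \<Omega>"
  using resolvent_mult that unfolding Omega_iff Gb_mat_def G_mat_def .

lemma u_xi: "((\<lambda>x. u x \<eta>) has_field_derivative v \<xi> \<eta> * \<phi> \<xi> \<eta>) (at \<xi>)" if "(\<xi>, \<eta>) \<in> \<Omega>"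
proof -
  interpret flow: cauchy_flow "\<lambda>x. A x \<eta>" "\<lambda>x. B x \<eta>" "\<lambda>x. ab x \<eta>" Li Lbi \<xi>
    by (rule flow_xi[OF that ab_xi])
  show ?thesis
    unfolding u_fun_def v_fun_def phi_fun_def G_mat_def Gb_mat_def
    using DERIV_diff[OF DERIV_const flow.GA_derivative[OF Sylvester_inverse]] by simp
qed

lemma u_eta: "((\<lambda>y. u \<xi> y) has_field_derivative vb \<xi> \<eta> * \<psi> \<xi> \<eta>) (at \<eta>)" if "(\<xi>, \<eta>) \<in> \<Omega>"
proof -
  interpret flow: cauchy_flow "\<lambda>y. A \<xi> y" "\<lambda>y. B \<xi> y" "\<lambda>y. ab \<xi> y" "- diag L" "- diag Lb" \<eta>
    by (rule flow_eta[OF that ab_eta])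
  show ?thesis
    unfolding u_fun_def vb_fun_def psi_fun_def G_mat_def Gb_mat_def
    using DERIV_diff[OF DERIV_const flow.GA_derivative[OF Sylvester, of \<beta>b]] by (simp add: mult.commute)
qed

text \<open>\<open>G_derivative_right\<close> yields \<phi>b from the linear term and
  \<open>(1 - u) * (- \<phi>b)\<close> from the rank-one term.\<close>

lemma v_xi: "((\<lambda>x. v x \<eta>) has_field_derivative u \<xi> \<eta> * \<phi>b \<xi> \<eta>) (at \<xi>)" if "(\<xi>, \<eta>) \<in> \<Omega>"
proof -
  interpret flow: cauchy_flow "\<lambda>x. A x \<eta>" "\<lambda>x. B x \<eta>" "\<lambda>x. ab x \<eta>" Li Lbi \<xi>
    by (rule flow_xi[OF that ab_xi])
  show ?thesis
    unfolding u_fun_def v_fun_def phib_fun_def G_mat_def row_col_vector_matrix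
    using flow.G_derivative_right[OF Sylvester_bar_inverse, of \<beta>]
    by (simp add: row_col_vector_matrix matrix_vector_mul_assoc algebra_simps)
qed

text \<open>The left form is used because \<open>Tb\<close> then acts on \<beta>, and
  \<open>diag Lb *v \<beta> = \<alpha>\<close>. The two terms are \<open>- \<psi>\<close> and
  \<open>(1 - ub) * \<psi>\<close>.\<close>

lemma v_eta: "((\<lambda>y. v \<xi> y) has_field_derivative - (ub \<xi> \<eta> * \<psi> \<xi> \<eta>)) (at \<eta>)"
  if "(\<xi>, \<eta>) \<in> \<Omega>"
proof -
  interpret flow: cauchy_flow "\<lambda>y. A \<xi> y" "\<lambda>y. B \<xi> y" "\<lambda>y. ab \<xi> y" "- diag L" "- diag Lb" \<eta>
    by (rule flow_eta[OF that ab_eta])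
  have *: "diag Lb *v \<beta> = \<alpha>"
    by (simp add: beta_col_def matrix_vector_mul_assoc Lbi_inverse)
  have "row_col r ((M ** - diag Lb) *v \<beta>) = - row_col r (M *v \<alpha>)"
    for r :: "complex ^ 'n" and M :: "complex ^ 'n ^ 'n"
    by (simp add: matrix_mul_minus_right row_col_linear matrix_vector_mul_assoc[symmetric] *)
  then show ?thesis
    unfolding ub_fun_def Gb_mult_B[OF that] v_fun_def psi_fun_def G_mat_def
    using flow.G_derivative_left[OF Sylvester, of \<beta>] by (simp add: algebra_simps)
qed

text \<open>Here \<open>Lbi *v \<alpha> = \<beta>\<close> makes the linear term \<open>v\<close>,
  and the second scalar of the rank-one term is \<open>u - 1\<close> in the form given by
  \<open>u_alt\<close>.\<close>

lemma psi_xi: "((\<lambda>x. \<psi> x \<eta>) has_field_derivative u \<xi> \<eta> * v \<xi> \<eta>) (at \<xi>)"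
  if "(\<xi>, \<eta>) \<in> \<Omega>"
proof -
  interpret flow: cauchy_flow "\<lambda>x. A x \<eta>" "\<lambda>x. B x \<eta>" "\<lambda>x. ab x \<eta>" Li Lbi \<xi>
    by (rule flow_xi[OF that ab_xi])
  show ?thesis
    unfolding u_alt[OF that] v_fun_def psi_fun_def G_mat_def
    using DERIV_minus[OF flow.G_derivative_left[OF Sylvester_inverse, of \<alpha>]]
    by (simp add: beta_col_def matrix_vector_mul_assoc algebra_simps)
qed

lemma bar: "soliton Lb L"
  using L Lb L_Lb by unfold_locales metis+

lemma bar_Omega: "(- \<xi>, - \<eta>) \<in> Omega Lb L \<alpha>b \<alpha> cb c" if "(\<xi>, \<eta>) \<in> \<Omega>"
  using det_swap_ne_0 that unfolding Omega_iff soliton.Omega_iff[OF bar] bar_swap .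

lemma ub_alt: "ub \<xi> \<eta> = 1 + row_col (ab \<xi> \<eta> v* Lbi) ((G \<xi> \<eta> ** A \<xi> \<eta>) *v \<alpha>b)"
  if "(\<xi>, \<eta>) \<in> \<Omega>"
  using soliton.u_alt[OF bar bar_Omega[OF that]] unfolding G_mult_A[OF that] bar_swap bar_swap_fun .

text \<open>The right form is used because \<open>Tb\<close> then meets the factor
  \<open>Lbi\<close> of the row and cancels it, leaving \<open>v\<close>. The rank-one term is
  \<open>(ub - 1) * v\<close> by \<open>ub_alt\<close>.\<close>

lemma phib_eta: "((\<lambda>y. \<phi>b \<xi> y) has_field_derivative - (ub \<xi> \<eta> * v \<xi> \<eta>)) (at \<eta>)"
  if "(\<xi>, \<eta>) \<in> \<Omega>"
proof -
  interpret flow: cauchy_flow "\<lambda>y. A \<xi> y" "\<lambda>y. B \<xi> y" "\<lambda>y. ab \<xi> y v* Lbi" "- diag L" "- diag Lb" \<eta>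
    by (rule flow_eta[OF that ab_Lbi_eta])
  have "row_col (r v* Lbi) ((- diag Lb ** M) *v s) = - row_col r (M *v s)"
    for r s :: "complex ^ 'n" and M :: "complex ^ 'n ^ 'n"
    by (simp add: matrix_mul_minus_left matrix_mul_minus_right row_col_linear row_col_vector_matrix
        matrix_vector_mul_assoc matrix_mul_assoc Lbi_inverse)
  then show ?thesis
    unfolding ub_alt[OF that] v_fun_def phib_fun_def G_mat_def
    using DERIV_minus[OF flow.G_derivative_right[OF Sylvester_bar, of \<beta>]]
    by (simp add: algebra_simps)
qed

text \<open>The commutator of \<open>B\<close> multiplied by \<open>G ** A\<close> on both sides is
  rewritten, by the resolvent identities \<open>1\<close> and \<open>2\<close>, through the
  commutator of \<open>A\<close>. Both have rank one, so a scalar product of each side gives a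
  product of fields, up to linear terms.\<close>

lemma u_ub_v_vb: "1 - u \<xi> \<eta> * ub \<xi> \<eta> = v \<xi> \<eta> * vb \<xi> \<eta>" if "(\<xi>, \<eta>) \<in> \<Omega>"
proof -
  let ?A = "A \<xi> \<eta>" and ?B = "B \<xi> \<eta>" and ?G = "G \<xi> \<eta>" and ?Gb = "Gb \<xi> \<eta>"
  have 1: "?G ** (?A ** ?B) = mat 1 - ?G"
    using matrix_inv_inverse(2)[of "mat 1 + ?A ** ?B"] that
    unfolding Omega_iff G_mat_def[symmetric] by (simp add: matrix_ring_simps algebra_simps)
  have 2: "?B ** ?A ** ?Gb = mat 1 - ?Gb"
    using matrix_inv_inverse(1)[OF det_swap_ne_0, of ?A ?B] that
    unfolding Omega_iff Gb_mat_def[symmetric] by (simp add: matrix_ring_simps algebra_simps)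
  have "?G ** ?A ** col_row \<alpha>b (ab \<xi> \<eta>) ** ?G ** ?A
      = ?G ** ?A ** (diag L ** ?B - ?B ** diag Lb) ** (?A ** ?Gb)"
    unfolding Ab_mat_Sylvester[OF Lb L_Lb] G_mult_A[OF that, symmetric] by (simp add: matrix_mul_assoc)
  also have "\<dots> = ?G ** ?A ** diag L ** (?B ** ?A ** ?Gb) - (?G ** (?A ** ?B)) ** diag Lb ** ?A ** ?Gb"
    by (simp add: matrix_ring_simps)
  also have "\<dots> = ?G ** ?A ** diag L - diag Lb ** (?A ** ?Gb)
      + ?G ** (diag Lb ** ?A - ?A ** diag L) ** ?Gb"
    unfolding 1 2 by (simp add: matrix_ring_simps)
  also have "\<dots> = ?G ** ?A ** diag L - diag Lb ** ?G ** ?A + ?G ** col_row \<alpha> (a \<xi> \<eta>) ** ?Gb"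
    unfolding A_mat_Sylvester[OF L L_Lb] G_mult_A[OF that, symmetric] by (simp add: matrix_mul_assoc)
  finally have "(?G ** ?A) ** col_row \<alpha>b (ab \<xi> \<eta>) ** (?G ** ?A)
      = ?G ** ?A ** diag L - diag Lb ** ?G ** ?A + ?G ** col_row \<alpha> (a \<xi> \<eta>) ** ?Gb"
    by (simp add: matrix_mul_assoc)
  \<comment> \<open>With this row and column the rank-one terms become
    \<open>(ub - 1) * (1 - u)\<close> and \<open>v * vb\<close>. In the remaining terms
    \<open>diag L\<close> turns \<beta>b into \<alpha>b and \<open>diag Lb\<close> cancels
    \<open>Lbi\<close>.\<close>
  from arg_cong[OF this, of "\<lambda>M. row_col (ab \<xi> \<eta> v* Lbi) (M *v \<beta>b)"]
  have "(ub \<xi> \<eta> - 1) * (1 - u \<xi> \<eta>)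
      = row_col (ab \<xi> \<eta> v* Lbi) ((?G ** ?A ** diag L) *v \<beta>b)
        - row_col (ab \<xi> \<eta> v* Lbi) ((diag Lb ** ?G ** ?A) *v \<beta>b)
        + v \<xi> \<eta> * vb \<xi> \<eta>"
    unfolding ub_alt[OF that] v_alt[OF that] u_fun_def vb_fun_def row_col_linear row_col_col_row by simp
  also have "row_col (ab \<xi> \<eta> v* Lbi) ((?G ** ?A ** diag L) *v \<beta>b) = ub \<xi> \<eta> - 1"
    unfolding ub_alt[OF that]
    by (simp add: betab_col_def matrix_vector_mul_assoc Li_inverse matrix_mul_assoc[symmetric])
  also have "row_col (ab \<xi> \<eta> v* Lbi) ((diag Lb ** ?G ** ?A) *v \<beta>b) = 1 - u \<xi> \<eta>"
    by (simp add: u_fun_def row_col_vector_matrix matrix_vector_mul_assoc matrix_mul_assoc Lbi_inverse)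
  finally show ?thesis
    by (simp add: algebra_simps)
qed

end

section \<open>Barred equations and the Euler equations for both pairs\<close>

lemma has_field_derivative_reflect:
  fixes f :: "complex \<Rightarrow> complex"
  assumes "(f has_field_derivative D) (at (- t))"
  shows "((\<lambda>x. f (- x)) has_field_derivative - D) (at t)"
proof -
  have "(uminus has_field_derivative - 1) (at t)"
    by (auto intro!: derivative_eq_intros)
  from DERIV_chain2[OF assms this] show ?thesis
    by simp
qed

context soliton
begin

text \<open>These are the equations already proved, for the exchanged data at
  \<open>(- \<xi>, - \<eta>)\<close>; the chain rule for the reflection reverses every sign.\<close>

lemma ub_eta: "((\<lambda>y. ub \<xi> y) has_field_derivative - (v \<xi> \<eta> * \<psi>b \<xi> \<eta>)) (at \<eta>)"
  and ub_xi: "((\<lambda>x. ub x \<eta>) has_field_derivative - (vb \<xi> \<eta> * \<phi>b \<xi> \<eta>)) (at \<xi>)"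
  and vb_xi: "((\<lambda>x. vb x \<eta>) has_field_derivative - (ub \<xi> \<eta> * \<phi> \<xi> \<eta>)) (at \<xi>)"
  and vb_eta: "((\<lambda>y. vb \<xi> y) has_field_derivative u \<xi> \<eta> * \<psi>b \<xi> \<eta>) (at \<eta>)"
  and psib_xi: "((\<lambda>x. \<psi>b x \<eta>) has_field_derivative - (ub \<xi> \<eta> * vb \<xi> \<eta>)) (at \<xi>)"
  and phi_eta: "((\<lambda>y. \<phi> \<xi> y) has_field_derivative u \<xi> \<eta> * vb \<xi> \<eta>) (at \<eta>)"
  if "(\<xi>, \<eta>) \<in> \<Omega>" for \<xi> \<eta>
  using has_field_derivative_reflect[OF soliton.u_eta[OF bar bar_Omega[OF that]]]
    has_field_derivative_reflect[OF soliton.u_xi[OF bar bar_Omega[OF that]]]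
    has_field_derivative_reflect[OF soliton.v_xi[OF bar bar_Omega[OF that]]]
    has_field_derivative_reflect[OF soliton.v_eta[OF bar bar_Omega[OF that]]]
    has_field_derivative_reflect[OF soliton.psi_xi[OF bar bar_Omega[OF that]]]
    has_field_derivative_reflect[OF soliton.phib_eta[OF bar bar_Omega[OF that]]]
  unfolding bar_swap_fun minus_minus .

lemma open_Omega: "open \<Omega>"
proof -
  have "continuous_on UNIV (\<lambda>p. (mat 1 + A (fst p) (snd p) ** B (fst p) (snd p)) $ i $ j)" for i j
  proof -
    have "Lb $ j - L $ k \<noteq> 0" "L $ j - Lb $ k \<noteq> 0" for j k
      using L_Lb[of k j] L_Lb[of j k] by auto
    then show ?thesis
      unfolding matrix_matrix_mult_def vector_add_component vec_lambda_beta A_nth B_nth a_nth ab_nth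
      by (intro continuous_intros) (use L Lb in auto)
  qed
  then have "continuous_on UNIV (\<lambda>p. det (mat 1 + A (fst p) (snd p) ** B (fst p) (snd p)))"
    unfolding continuous_on_def by (auto intro!: tendsto_det)
  moreover have "\<Omega> = {p. det (mat 1 + A (fst p) (snd p) ** B (fst p) (snd p)) \<noteq> 0}"
    by (auto simp: Omega_iff)
  ultimately show ?thesis
    by (simp add: open_Collect_neq)
qed

lemma euler_equations_u:
  assumes "(\<xi>, \<eta>) \<in> \<Omega>" "u \<xi> \<eta> * ub \<xi> \<eta> \<noteq> 1"
  shows "euler_equations_at L_plus u ub \<xi> \<eta>"
proof -
  have "L_plus = (\<lambda>w wb p q. p * q / (1 - w * wb) + 1 * (w * wb))"
    by (simp add: L_plus_def fun_eq_iff)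
  moreover have "euler_equations_at \<dots> u ub \<xi> \<eta>"
  \<comment> \<open>The minus sign in \<open>Q\<close> absorbs the one in \<open>ub_eta\<close>;
    \<open>psib_xi\<close> and \<open>phi_eta\<close> then both give \<sigma> = 1.\<close>
  proof (rule euler_equations_of_first_order_system[where S = \<Omega> and w = u and wb = ub and W = v and Wb = vb
        and P = \<phi> and Q = "\<lambda>x y. - \<psi>b x y"])
    fix x y assume *: "(x, y) \<in> \<Omega>"
    show "isCont (\<lambda>x. v x y) x" "isCont (\<lambda>y. v x y) y"
      using DERIV_isCont v_xi[OF *] v_eta[OF *] by blast+
    show "((\<lambda>x. - \<psi>b x y) has_field_derivative 1 * (ub x y * vb x y)) (at x)"
      using DERIV_minus[OF psib_xi[OF *]] by simp
  qed (use open_Omega assms u_xi ub_eta u_ub_v_vb vb_xi phi_eta vb_eta in auto)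
  ultimately show ?thesis
    by simp
qed

lemma euler_equations_v:
  assumes "(\<xi>, \<eta>) \<in> \<Omega>" "v \<xi> \<eta> * vb \<xi> \<eta> \<noteq> 1"
  shows "euler_equations_at L_minus v vb \<xi> \<eta>"
proof -
  have "L_minus = (\<lambda>w wb p q. p * q / (1 - w * wb) + - 1 * (w * wb))"
    by (simp add: L_minus_def fun_eq_iff)
  moreover have "euler_equations_at \<dots> v vb \<xi> \<eta>"
  \<comment> \<open>The two pairs exchange roles. Now \<open>psib_xi\<close> and
    \<open>phib_eta\<close> both carry a minus sign, so \<sigma> = -1.\<close>
  proof (rule euler_equations_of_first_order_system[where S = \<Omega> and w = v and wb = vb and W = u and Wb = ub
        and P = \<phi>b and Q = \<psi>b])
    fix x y assume *: "(x, y) \<in> \<Omega>"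
    show "isCont (\<lambda>x. u x y) x" "isCont (\<lambda>y. u x y) y"
      using DERIV_isCont u_xi[OF *] u_eta[OF *] by blast+
    show "1 - v x y * vb x y = u x y * ub x y"
      using u_ub_v_vb[OF *] by (simp add: algebra_simps)
  qed (use open_Omega assms v_xi vb_eta psib_xi ub_xi phib_eta ub_eta in \<open>auto simp: mult.commute\<close>)
  ultimately show ?thesis
    by simp
qed

end

theorem proposition3p1:
  fixes L Lb \<alpha> \<alpha>b c cb :: "complex ^ 'n"
  assumes "\<And>j. L $ j \<noteq> 0"
    and "\<And>j. Lb $ j \<noteq> 0"
    and "\<And>j k. L $ j \<noteq> Lb $ k"
  shows "(\<forall>(\<xi>, \<eta>) \<in> Omega L Lb \<alpha> \<alpha>b c cb.
            u_fun L Lb \<alpha> \<alpha>b c cb \<xi> \<eta> * ub_fun L Lb \<alpha> \<alpha>b c cb \<xi> \<eta> \<noteq> 1 \<longrightarrow>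
            euler_equations_at L_plus (u_fun L Lb \<alpha> \<alpha>b c cb) (ub_fun L Lb \<alpha> \<alpha>b c cb) \<xi> \<eta>)
       \<and> (\<forall>(\<xi>, \<eta>) \<in> Omega L Lb \<alpha> \<alpha>b c cb.
            v_fun L Lb \<alpha> \<alpha>b c cb \<xi> \<eta> * vb_fun L Lb \<alpha> \<alpha>b c cb \<xi> \<eta> \<noteq> 1 \<longrightarrow>
            euler_equations_at L_minus (v_fun L Lb \<alpha> \<alpha>b c cb) (vb_fun L Lb \<alpha> \<alpha>b c cb) \<xi> \<eta>)"
proof -
  interpret soliton L Lb \<alpha> \<alpha>b c cb
    by unfold_locales (fact assms)+
  show ?thesis
    using euler_equations_u euler_equations_v by auto
qed

end
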